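(* Let $\mathcal{X}\subset\mathbb{R}^n$ be a compact convex set with non-empty interior, $c\in\mathbb{R}^n$, and let $F$ be a $\nu$-self-concordant barrier for $\mathcal{X}$. For $t\ge 0$ let $F_t(x)=tc^\top x+F(x)$. Let $t_0>0$ and $x_0\in\mathrm{int}(\mathcal{X})$ be such that $\lambda_{F_{t_0}}(x_0)\le 1/4$. Define the path-following scheme, for $k\ge 0$, by $$t_{k+1}=\left(1+\frac{1}{13\sqrt\nu}\right)t_k,\qquad x_{k+1}=x_k-[\nabla^2F(x_k)]^{-1}\left(t_{k+1}c+\nabla F(x_k)\right).$$ Then for every $k\ge 0$, $$c^\top x_k-\min_{x\in\mathcal{X}}c^\top x\le\frac{2\nu}{t_0}\exp\left(-\frac{k}{1+13\sqrt\nu}\right).$$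
   Context: $F:\mathrm{int}(\mathcal{X})\to\mathbb{R}$ is a barrier for $\mathcal{X}$ if $F(x)\to+\infty$ as $x\to\partial\mathcal{X}$; only strictly convex barriers are considered. For a $C^3$ convex function $f$ on $\mathrm{int}(\mathcal{X})$ put $\|h\|_x=\sqrt{h^\top\nabla^2f(x)h}$, with dual norm $\|g\|_x^*=\sup\{g^\top h:\|h\|_x\le 1\}=\sqrt{g^\top[\nabla^2f(x)]^{-1}g}$. $f$ is standard self-concordant if $\nabla^3f(x)[h,h,h]\le 2\|h\|_x^3$ for all $x\in\mathrm{int}(\mathcal{X})$, $h\in\mathbb{R}^n$. $F$ is a $\nu$-self-concordant barrier for $\mathcal{X}$ if it is a barrier for $\mathcal{X}$, is standard self-concordant, and is $\frac1\nu$-exp-concave, i.e. $x\mapsto\exp(-\frac1\nu F(x))$ is concave (equivalently $\nabla^2F(x)\succeq\frac1\nu\nabla F(x)\nabla F(x)^\top$). The Newton decrement of $f$ at $x$ is $\lambda_f(x)=\|\nabla f(x)\|_x^*$; in particular $\lambda_{F_t}(x)=\|tc+\nabla F(x)\|_x^*$ where $\|\cdot\|_x^*$ is taken with respect to $\nabla^2F_t(x)=\nabla^2F(x)$. *)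

theory Defs
  imports "HOL-Analysis.Analysis"
begin

definition grad :: "(real ^ 'n \<Rightarrow> real) \<Rightarrow> real ^ 'n \<Rightarrow> real ^ 'n" where
  "grad f x = (\<chi> i. frechet_derivative f (at x) (axis i 1))"

definition hess :: "(real ^ 'n \<Rightarrow> real) \<Rightarrow> real ^ 'n \<Rightarrow> real ^ 'n ^ 'n" where
  "hess f x = jacobian (grad f) (at x)"

(* The directional derivative of the Hessian: dhess f x u is the matrix of the
   bilinear form (v, w) \<mapsto> D^3 f(x)[u, v, w]. *)
definition dhess :: "(real ^ 'n \<Rightarrow> real) \<Rightarrow> real ^ 'n \<Rightarrow> real ^ 'n \<Rightarrow> real ^ 'n ^ 'n" where
  "dhess f x u = frechet_derivative (hess f) (at x) u"

(* Intended for open S. In finite dimension, continuity of x \<mapsto> D^3 f(x) is the same as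
   continuity of x \<mapsto> dhess f x u for each fixed direction u. *)
definition C3_on :: "(real ^ 'n) set \<Rightarrow> (real ^ 'n \<Rightarrow> real) \<Rightarrow> bool" where
  "C3_on S f \<longleftrightarrow>
     (\<forall>x\<in>S. f differentiable (at x)) \<and>
     (\<forall>x\<in>S. grad f differentiable (at x)) \<and>
     (\<forall>x\<in>S. hess f differentiable (at x)) \<and>
     (\<forall>u. continuous_on S (\<lambda>x. dhess f x u))"

definition local_norm :: "(real ^ 'n \<Rightarrow> real) \<Rightarrow> real ^ 'n \<Rightarrow> real ^ 'n \<Rightarrow> real" where
  "local_norm f x h = sqrt (h \<bullet> (hess f x *v h))"

(* The supremum is finite when hess f x is positive definite; for a real Sup over an
   unbounded set the value would be unspecified. *)
definition dual_local_norm :: "(real ^ 'n \<Rightarrow> real) \<Rightarrow> real ^ 'n \<Rightarrow> real ^ 'n \<Rightarrow> real" where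
  "dual_local_norm f x g = (SUP h\<in>{h. local_norm f x h \<le> 1}. g \<bullet> h)"

definition newton_decrement :: "(real ^ 'n \<Rightarrow> real) \<Rightarrow> real ^ 'n \<Rightarrow> real" where
  "newton_decrement f x = dual_local_norm f x (grad f x)"

definition strictly_convex_on :: "(real ^ 'n) set \<Rightarrow> (real ^ 'n \<Rightarrow> real) \<Rightarrow> bool" where
  "strictly_convex_on S f \<longleftrightarrow> convex S \<and>
     (\<forall>x\<in>S. \<forall>y\<in>S. \<forall>u. x \<noteq> y \<longrightarrow> 0 < u \<longrightarrow> u < 1 \<longrightarrow>
        f ((1 - u) *\<^sub>R x + u *\<^sub>R y) < (1 - u) * f x + u * f y)"

(* Only the values of F on interior X matter, here and below. Strict convexity is part of
   the notion, as only strictly convex barriers are considered. *)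
definition barrier :: "(real ^ 'n) set \<Rightarrow> (real ^ 'n \<Rightarrow> real) \<Rightarrow> bool" where
  "barrier X F \<longleftrightarrow>
     strictly_convex_on (interior X) F \<and>
     (\<forall>y\<in>frontier X. filterlim F at_top (at y within interior X))"

(* Replacing h by -h shows that the inequality bounds the absolute value of the
   third-order form as well. *)
definition standard_self_concordant :: "(real ^ 'n) set \<Rightarrow> (real ^ 'n \<Rightarrow> real) \<Rightarrow> bool" where
  "standard_self_concordant X f \<longleftrightarrow>
     C3_on (interior X) f \<and> convex_on (interior X) f \<and>
     (\<forall>x\<in>interior X. \<forall>h. h \<bullet> (dhess f x h *v h) \<le> 2 * local_norm f x h ^ 3)"

definition self_concordant_barrier ::
    "real \<Rightarrow> (real ^ 'n) set \<Rightarrow> (real ^ 'n \<Rightarrow> real) \<Rightarrow> bool" where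
  "self_concordant_barrier \<nu> X F \<longleftrightarrow>
     0 < \<nu> \<and> barrier X F \<and> standard_self_concordant X F \<and>
     concave_on (interior X) (\<lambda>x. exp (- (1 / \<nu>) * F x))"

definition penalized :: "real ^ 'n \<Rightarrow> (real ^ 'n \<Rightarrow> real) \<Rightarrow> real \<Rightarrow> real ^ 'n \<Rightarrow> real" where
  "penalized c F t x = t * (c \<bullet> x) + F x"

end

theory Submission
  imports Defs
begin

text \<open>
  Write \<open>\<parallel>u\<parallel>\<^sub>x\<close> for the local norm of \<open>F\<close>. The scheme keeps the invariant
  \<open>u \<bullet> (t c + \<nabla>F(x)) \<le> \<parallel>u\<parallel>\<^sub>x / 4\<close> for all \<open>u\<close>, that is, decrement at most \<open>1/4\<close>. The theorem
  follows because the invariant at \<open>(t, x)\<close> bounds the optimality gap by \<open>2 \<nu> / t\<close>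
  (\<open>path_gap\<close>) and because \<open>t\<close> grows geometrically (\<open>geometric_growth_bound\<close>).

  \<^bold>\<open>Preserving the invariant\<close> (\<open>path_following_step\<close>). Exp-concavity bounds the dual norm of
  \<open>\<nabla>F\<close> by \<open>sqrt \<nu>\<close>, so raising \<open>t\<close> by the factor \<open>1 + 1/(13 sqrt \<nu>)\<close> raises the decrement to
  at most \<open>1/4 + 1/52 + 1/13 = 9/26\<close>; the middle term needs \<open>\<nu> \<ge> 1\<close>, which is a theorem about
  barriers of bounded sets (\<open>nu_ge_1\<close>). The Newton step must then bring \<open>9/26\<close> back to
  \<open>1/4\<close>. The familiar estimate \<open>(L / (1 - L))\<^sup>2\<close> gives only \<open>(9/17)\<^sup>2 > 1/4\<close>. It loses because it
  bounds the change of the gradient in the norm of the old point and then pays the full factor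
  \<open>1 / (1 - L)\<close> for passing to the norm of the new one. In \<open>newton_step\<close> the
  third-order term \<open>D\<^sup>3F[u,h,h]\<close> is instead integrated along the step with all three local norms
  taken at the current point, which yields
  \<open>L\<^sup>2 (3 - 2 L) / (3 (1 - L)\<^sup>2)\<close>, about \<open>0.216\<close> at \<open>L = 9/26\<close>.

  \<^bold>\<open>Mixed third derivatives.\<close> That argument needs \<open>\<bar>D\<^sup>3F[u,v,v]\<bar> \<le> 2 \<parallel>u\<parallel>\<^sub>x \<parallel>v\<parallel>\<^sub>x\<^sup>2\<close>, whereas
  self-concordance only speaks of \<open>u = v\<close>. In the plane spanned by \<open>u\<close> and \<open>v\<close> the form becomes a
  binary cubic, and \<open>planar_cubic_coefficient_bound\<close> is a Bernstein inequality for it. Symmetry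
  of \<open>D\<^sup>3F\<close> comes from the symmetry of second derivatives.

  \<^bold>\<open>The gap.\<close> The estimate is made directly at \<open>x\<close>. For \<open>y\<close> in \<open>X\<close> put \<open>d = y - x\<close>,
  \<open>r = \<parallel>d\<parallel>\<^sub>x\<close> and \<open>a = \<nabla>F(x) \<bullet> d\<close>. The invariant gives \<open>t c \<bullet> (x - y) \<le> r/4 + a\<close>. If \<open>r\<close> is large then
  self-concordance forces the slope of \<open>F\<close> along \<open>d\<close> to rise by \<open>3 r/4\<close> already at the point
  \<open>x + (3/r) d\<close>, whereas \<open>\<nabla>F(z) \<bullet> (y - z) \<le> \<nu>\<close> holds at every interior \<open>z\<close>
  (\<open>grad_gap\<close>). These two facts are incompatible unless \<open>r/4 + a \<le> 2 \<nu>\<close>.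

  The quantitative use of self-concordance is one-dimensional: along \<open>x + s h\<close> the function
  \<open>w(s) = \<parallel>h\<parallel>\<^sup>2\<close> satisfies \<open>\<bar>w'\<bar> \<le> 2 w\<^bsup>3/2\<^esup>\<close>, so \<open>1 / sqrt w\<close> is Lipschitz with constant 1.
\<close>

section \<open>Symmetric trilinear forms bounded on the diagonal\<close>

text \<open>
  With \<open>p(\<theta>)\<close> the cubic at \<open>(cos \<theta>, sin \<theta>)\<close>, the conclusion reads \<open>p(0)\<^sup>2 + (p'(0)/3)\<^sup>2 \<le> M\<^sup>2\<close>,
  the Bernstein-Szego inequality for frequencies 1 and 3. It holds because
  \<open>p(0) cos \<psi> + (p'(0)/3) sin \<psi>\<close> is a signed average of the values of \<open>p\<close> at the three angles
  \<open>\<psi>/3\<close> and \<open>\<psi>/3 \<plusminus> \<pi>/3\<close>, which are extremal points of \<open>cos (3 \<theta> - \<psi>)\<close>. The weight of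
  the node \<open>\<theta>\<close> is \<open>(1 + 2 cos (2 \<theta>))\<^sup>2 / 9\<close>. Choosing \<open>\<psi>\<close> as the polar angle of \<open>(a, b)\<close> turns the
  left-hand side into the length of \<open>(a, b)\<close>.
\<close>

lemma planar_cubic_coefficient_bound:
  fixes a b g d M :: real
  assumes P: "\<And>c s. c\<^sup>2 + s\<^sup>2 = 1 \<Longrightarrow> a * c ^ 3 + 3 * b * c\<^sup>2 * s + 3 * g * c * s\<^sup>2 + d * s ^ 3 \<le> M"
  shows "a\<^sup>2 + b\<^sup>2 \<le> M\<^sup>2"
proof (cases "a\<^sup>2 + b\<^sup>2 = 0")
  case False
  define p where "p c s = a * c ^ 3 + 3 * b * c\<^sup>2 * s + 3 * g * c * s\<^sup>2 + d * s ^ 3" for c s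
  have p_le: "p c s \<le> M" if "c\<^sup>2 + s\<^sup>2 = 1" for c s using P[OF that] by (simp add: p_def)
  define R where "R = sqrt (a\<^sup>2 + b\<^sup>2)"
  have R: "R > 0" "R\<^sup>2 = a\<^sup>2 + b\<^sup>2" using False by (auto simp: R_def sum_power2_gt_zero_iff)
  have "(a / R)\<^sup>2 + (b / R)\<^sup>2 = 1"
    using R by (simp add: power_divide add_divide_distrib[symmetric] R(2)[symmetric])
  then obtain \<psi> where "a / R = cos \<psi>" "b / R = sin \<psi>" by (rule sincos_total_2pi)
  then have ab: "a = R * cos \<psi>" "b = R * sin \<psi>" using R by (auto simp: field_simps)
  define c s r where "c = cos (\<psi> / 3)" and "s = sin (\<psi> / 3)" and "r = sqrt 3"
  have cs: "s\<^sup>2 = 1 - c\<^sup>2" by (simp add: c_def s_def sin_squared_eq)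
  have r: "r\<^sup>2 = 3" by (simp add: r_def)
  have cpsi: "cos \<psi> = 4 * c ^ 3 - 3 * c"
    using cos_treble_cos[of "\<psi> / 3"] by (simp add: c_def)
  have spsi: "sin \<psi> = 3 * s - 4 * s ^ 3"
  proof -
    have "sin \<psi> = sin (2 * (\<psi> / 3) + \<psi> / 3)" by simp
    also have "\<dots> = 2 * s * c * c + (c\<^sup>2 - s\<^sup>2) * s"
      by (simp only: sin_add sin_double cos_double c_def s_def)
    also have "\<dots> = 3 * s - 4 * s ^ 3" using cs by algebra
    finally show ?thesis .
  qed
  \<comment> \<open>The nodes at angles \<open>\<psi>/3 + \<pi>/3\<close> and \<open>\<psi>/3 - \<pi>/3\<close>.\<close>
  define c1 s1 c2 s2 where "c1 = (c - r * s) / 2" and "s1 = (s + r * c) / 2"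
    and "c2 = (c + r * s) / 2" and "s2 = (s - r * c) / 2"
  have dbl: "2 * c1 = c - r * s" "2 * s1 = s + r * c" "2 * c2 = c + r * s" "2 * s2 = s - r * c"
    by (simp_all add: c1_def s1_def c2_def s2_def)
  have circ: "c\<^sup>2 + s\<^sup>2 = 1" "c1\<^sup>2 + s1\<^sup>2 = 1" "c2\<^sup>2 + s2\<^sup>2 = 1"
  proof -
    show "c\<^sup>2 + s\<^sup>2 = 1" using cs by simp
    show "c1\<^sup>2 + s1\<^sup>2 = 1" using cs r dbl by algebra
    show "c2\<^sup>2 + s2\<^sup>2 = 1" using cs r dbl by algebra
  qed
  define w where "w x = (4 * x\<^sup>2 - 1)\<^sup>2 / 9" for x :: real
  have w: "9 * w x = ((2 * x)\<^sup>2 - 1)\<^sup>2" for x by (simp add: w_def power_mult_distrib)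
  have w0: "9 * w c = (4 * c\<^sup>2 - 1)\<^sup>2" and w1: "9 * w c1 = ((c - r * s)\<^sup>2 - 1)\<^sup>2"
    and w2: "9 * w c2 = ((c + r * s)\<^sup>2 - 1)\<^sup>2"
    using w[of c] w[of c1] w[of c2] by (simp_all only: dbl) (simp add: power_mult_distrib)
  have w_sum: "w c + w c1 + w c2 = 1"
    using w0 w1 w2 cs r by algebra
  \<comment> \<open>The average reproduces each of the four monomials of \<open>p\<close>; scaling by 72 clears all
    denominators.\<close>
  have k0: "w c * c ^ 3 - w c1 * c1 ^ 3 - w c2 * c2 ^ 3 = 4 * c ^ 3 - 3 * c"
  proof -
    have "72 * (w c * c ^ 3 - w c1 * c1 ^ 3 - w c2 * c2 ^ 3) =
      8 * (9 * w c) * c ^ 3 - (9 * w c1) * (2 * c1) ^ 3 - (9 * w c2) * (2 * c2) ^ 3"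
      by (simp add: algebra_simps power_mult_distrib)
    also have "\<dots> = 72 * (4 * c ^ 3 - 3 * c)"
      unfolding w0 w1 w2 dbl using cs r by algebra
    finally show ?thesis by simp
  qed
  have k1: "3 * (w c * (c\<^sup>2 * s) - w c1 * (c1\<^sup>2 * s1) - w c2 * (c2\<^sup>2 * s2)) = 3 * s - 4 * s ^ 3"
  proof -
    have "72 * (w c * (c\<^sup>2 * s) - w c1 * (c1\<^sup>2 * s1) - w c2 * (c2\<^sup>2 * s2)) =
      8 * (9 * w c) * (c\<^sup>2 * s) - (9 * w c1) * ((2 * c1)\<^sup>2 * (2 * s1)) - (9 * w c2) * ((2 * c2)\<^sup>2 * (2 * s2))"
      by (simp add: algebra_simps power_mult_distrib)
    also have "\<dots> = 24 * (3 * s - 4 * s ^ 3)"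
      unfolding w0 w1 w2 dbl using cs r by algebra
    finally show ?thesis by simp
  qed
  have k2: "w c * (c * s\<^sup>2) - w c1 * (c1 * s1\<^sup>2) - w c2 * (c2 * s2\<^sup>2) = 0"
  proof -
    have "72 * (w c * (c * s\<^sup>2) - w c1 * (c1 * s1\<^sup>2) - w c2 * (c2 * s2\<^sup>2)) =
      8 * (9 * w c) * (c * s\<^sup>2) - (9 * w c1) * ((2 * c1) * (2 * s1)\<^sup>2) - (9 * w c2) * ((2 * c2) * (2 * s2)\<^sup>2)"
      by (simp add: algebra_simps power_mult_distrib)
    also have "\<dots> = 0"
      unfolding w0 w1 w2 dbl using cs r by algebra
    finally show ?thesis by simp
  qed
  have k3: "w c * s ^ 3 - w c1 * s1 ^ 3 - w c2 * s2 ^ 3 = 0"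
  proof -
    have "72 * (w c * s ^ 3 - w c1 * s1 ^ 3 - w c2 * s2 ^ 3) =
      8 * (9 * w c) * s ^ 3 - (9 * w c1) * (2 * s1) ^ 3 - (9 * w c2) * (2 * s2) ^ 3"
      by (simp add: algebra_simps power_mult_distrib)
    also have "\<dots> = 0"
      unfolding w0 w1 w2 dbl using cs r by algebra
    finally show ?thesis by simp
  qed
  have "R\<^sup>2 = R * (a * cos \<psi> + b * sin \<psi>)"
    unfolding R(2) by (subst (1 2) ab) (simp add: ab power2_eq_square algebra_simps)
  then have "R = a * (4 * c ^ 3 - 3 * c) + b * (3 * s - 4 * s ^ 3)"
    using R by (simp add: cpsi spsi power2_eq_square)
  also have "\<dots> = w c * p c s - w c1 * p c1 s1 - w c2 * p c2 s2"
    unfolding p_def k0[symmetric] k1[symmetric] using k2 k3 by algebra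
  also have "\<dots> = w c * p c s + w c1 * p (- c1) (- s1) + w c2 * p (- c2) (- s2)"
    by (simp add: p_def algebra_simps)
  also have "\<dots> \<le> w c * M + w c1 * M + w c2 * M"
    using circ by (intro add_mono mult_left_mono p_le) (simp_all add: w_def)
  also have "\<dots> = M" using w_sum by (simp flip: distrib_right)
  finally have "R \<le> M" .
  then show ?thesis using R by (metis less_imp_le power_mono)
next
  case True then show ?thesis by simp
qed

text \<open>
  In an orthonormal basis \<open>e1\<close>, \<open>e2\<close> of the plane spanned by \<open>v\<close> and \<open>u\<close>, with \<open>e1\<close> along \<open>v\<close>, the
  diagonal of \<open>T\<close> is a binary cubic bounded by \<open>M\<close> on the unit circle, and \<open>T u e1 e1\<close> is the inner
  product of the coordinates of \<open>u\<close> with the two coefficients that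
  \<open>planar_cubic_coefficient_bound\<close> controls.
\<close>

lemma symmetric_trilinear_bound:
  fixes B :: "'a::real_vector \<Rightarrow> 'a \<Rightarrow> real" and T :: "'a \<Rightarrow> 'a \<Rightarrow> 'a \<Rightarrow> real"
  assumes B: "\<And>a. linear (B a)" and Bsym: "\<And>a b. B a b = B b a"
    and Bpos: "\<And>a. a \<noteq> 0 \<Longrightarrow> 0 < B a a"
    and T: "\<And>a b. linear (T a b)"
    and Tsym: "\<And>a b c. T a b c = T b a c" "\<And>a b c. T a b c = T a c b"
    and bound: "\<And>h. T h h h \<le> M * sqrt (B h h) ^ 3" and "0 \<le> M"
  shows "\<bar>T u v v\<bar> \<le> M * sqrt (B u u) * B v v"
proof (cases "v = 0")
  case True
  then show ?thesis using linear_0[OF T] linear_0[OF B] by simp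
next
  case False
  note B3 = linear_add[OF B] linear_scale[OF B] linear_0[OF B] linear_diff[OF B] linear_neg[OF B]
  note T3 = linear_add[OF T] linear_scale[OF T] linear_0[OF T] linear_diff[OF T] linear_neg[OF T]
  have B2: "B (a + a') b = B a b + B a' b" "B (r *\<^sub>R a) b = r * B a b" for a a' b r
    using B3(1,2)[of b] by (simp_all add: Bsym[of _ b])
  have T2: "T a (b + b') c = T a b c + T a b' c" "T a (r *\<^sub>R b) c = r * T a b c" for a b b' c r
    using T3(1,2)[of a c] by (simp_all add: Tsym(2)[of a _ c])
  have T1: "T (a + a') b c = T a b c + T a' b c" "T (r *\<^sub>R a) b c = r * T a b c" for a a' b c r
    using T2[of b _ _ c] by (simp_all add: Tsym(1)[of b _ c])
  define n where "n = sqrt (B v v)"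
  have n: "n > 0" "n\<^sup>2 = B v v" using Bpos[OF False] by (auto simp: n_def)
  define e1 where "e1 = (1 / n) *\<^sub>R v"
  have v: "v = n *\<^sub>R e1" using n by (simp add: e1_def)
  have e11: "B e1 e1 = 1" using n(1) by (simp add: e1_def B2 B3 n(2)[symmetric] power2_eq_square)
  define p where "p = B u e1"
  define e where "e = u - p *\<^sub>R e1"
  have u: "u = p *\<^sub>R e1 + e" by (simp add: e_def)
  have e1e: "B e1 e = 0" by (simp add: e_def B3 e11 p_def Bsym[of u])
  have "\<bar>T u e1 e1\<bar> \<le> M * sqrt (B u u)"
  proof (cases "e = 0")
    case True
    have "\<bar>T e1 e1 e1\<bar> \<le> M"
      using bound[of e1] bound[of "(-1) *\<^sub>R e1"] unfolding T1 T2 T3 B2 B3 e11 by simp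
    then have "\<bar>p\<bar> * \<bar>T e1 e1 e1\<bar> \<le> \<bar>p\<bar> * M" by (intro mult_left_mono) auto
    then show ?thesis using True u by (simp add: T1 B2 B3 e11 abs_mult mult.commute)
  next
    case False
    define q where "q = sqrt (B e e)"
    have q: "q > 0" "q\<^sup>2 = B e e" using Bpos[OF False] by (auto simp: q_def)
    define e2 where "e2 = (1 / q) *\<^sub>R e"
    have e: "e = q *\<^sub>R e2" using q by (simp add: e2_def)
    have e22: "B e2 e2 = 1" using q(1) by (simp add: e2_def B2 B3 q(2)[symmetric] power2_eq_square)
    have e12: "B e1 e2 = 0" "B e2 e1 = 0" using e1e by (simp_all add: e2_def B3 B2 Bsym[of e])
    have "(T e1 e1 e1)\<^sup>2 + (T e1 e1 e2)\<^sup>2 \<le> M\<^sup>2"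
    proof (rule planar_cubic_coefficient_bound)
      fix c s :: real assume cs: "c\<^sup>2 + s\<^sup>2 = 1"
      let ?h = "c *\<^sub>R e1 + s *\<^sub>R e2"
      have "B ?h ?h = c\<^sup>2 + s\<^sup>2" by (simp add: B2 B3 e11 e12 e22 power2_eq_square)
      moreover have "T ?h ?h ?h = T e1 e1 e1 * c ^ 3 + 3 * T e1 e1 e2 * c\<^sup>2 * s
          + 3 * T e1 e2 e2 * c * s\<^sup>2 + T e2 e2 e2 * s ^ 3"
        using Tsym(1)[of e2 e1] Tsym(2)[of e1 e2 e1] Tsym(2)[of e2 e2 e1]
        by (simp add: T1 T2 T3 algebra_simps power2_eq_square power3_eq_cube)
      ultimately show "T e1 e1 e1 * c ^ 3 + 3 * T e1 e1 e2 * c\<^sup>2 * s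
          + 3 * T e1 e2 e2 * c * s\<^sup>2 + T e2 e2 e2 * s ^ 3 \<le> M"
        using bound[of ?h] cs by simp
    qed
    then have X1: "((T e1 e1 e1)\<^sup>2 + (T e1 e1 e2)\<^sup>2) * (p\<^sup>2 + q\<^sup>2) \<le> M\<^sup>2 * (p\<^sup>2 + q\<^sup>2)"
      by (rule mult_right_mono) simp
    have Tu: "T u e1 e1 = p * T e1 e1 e1 + q * T e1 e1 e2"
      using Tsym(1)[of e2 e1 e1] Tsym(2)[of e1 e2 e1] by (simp add: u e T1)
    have Bu: "B u u = p\<^sup>2 + q\<^sup>2"
      by (simp add: u e B2 B3 e11 e12 e22 power2_eq_square)
    have "(p * x + q * y)\<^sup>2 \<le> (x\<^sup>2 + y\<^sup>2) * (p\<^sup>2 + q\<^sup>2)" for x y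
    proof -
      have "(p * x + q * y)\<^sup>2 + (p * y - q * x)\<^sup>2 = (x\<^sup>2 + y\<^sup>2) * (p\<^sup>2 + q\<^sup>2)" by algebra
      then show ?thesis using zero_le_power2[of "p * y - q * x"] by linarith
    qed
    then have "(T u e1 e1)\<^sup>2 \<le> ((T e1 e1 e1)\<^sup>2 + (T e1 e1 e2)\<^sup>2) * (p\<^sup>2 + q\<^sup>2)"
      unfolding Tu .
    with X1 have "(T u e1 e1)\<^sup>2 \<le> M\<^sup>2 * (p\<^sup>2 + q\<^sup>2)" by linarith
    then have "(T u e1 e1)\<^sup>2 \<le> (M * sqrt (B u u))\<^sup>2" by (simp add: power_mult_distrib Bu)
    moreover have "0 \<le> M * sqrt (B u u)" using \<open>0 \<le> M\<close> by (simp add: Bu)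
    ultimately show ?thesis by (simp add: abs_le_square_iff[symmetric])
  qed
  then have "\<bar>T u e1 e1\<bar> * n\<^sup>2 \<le> M * sqrt (B u u) * n\<^sup>2" by (rule mult_right_mono) simp
  moreover have "T u v v = T u e1 e1 * n\<^sup>2" by (simp add: v T2 T3 power2_eq_square)
  ultimately show ?thesis using Bpos[OF False] by (simp add: n(2) abs_mult)
qed

section \<open>Symmetry of second derivatives\<close>

text \<open>
  Apply the mean value theorem to \<open>s \<mapsto> f (x + s a + t b) - f (x + s a)\<close>, and expand the derivative
  that appears to first order at \<open>x\<close>. Exchanging \<open>a\<close> and \<open>b\<close> leaves the second difference
  unchanged, which is why second derivatives are symmetric.
\<close>

lemma second_difference_quotient:
  fixes f :: "'a::real_normed_vector \<Rightarrow> real"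
  assumes S: "open S" "x \<in> S" and f: "\<And>y. y \<in> S \<Longrightarrow> (f has_derivative f' y) (at y)"
    and A: "((\<lambda>y. f' y a) has_derivative A) (at x)" and "\<epsilon> > 0"
  shows "\<exists>\<delta>>0. \<forall>t. 0 < t \<and> t < \<delta> \<longrightarrow>
    \<bar>(f (x + t *\<^sub>R a + t *\<^sub>R b) - f (x + t *\<^sub>R a) - f (x + t *\<^sub>R b) + f x) - t\<^sup>2 * A b\<bar> \<le> \<epsilon> * t\<^sup>2"
proof -
  define K where "K = norm a + norm b"
  have K: "K \<ge> 0" "norm a \<le> K" by (auto simp: K_def)
  define e where "e = \<epsilon> / (2 * K + 1)"
  have e: "e > 0" "e * (2 * K) \<le> \<epsilon>" using K \<open>\<epsilon> > 0\<close> by (auto simp: e_def field_simps)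
  interpret A: bounded_linear A using A by (rule has_derivative_bounded_linear)
  obtain d where d: "d > 0"
    and dA: "\<And>y. norm (y - x) < d \<Longrightarrow> \<bar>f' y a - f' x a - A (y - x)\<bar> \<le> e * norm (y - x)"
    using A e(1) unfolding has_derivative_at_alt by (auto simp: real_norm_def)
  obtain \<rho> where \<rho>: "\<rho> > 0" "\<And>y. norm (y - x) < \<rho> \<Longrightarrow> y \<in> S"
    using S by (auto simp: open_dist dist_norm)
  define \<delta> where "\<delta> = min d \<rho> / (K + 1)"
  have "\<delta> > 0" using d \<rho> K by (auto simp: \<delta>_def)
  moreover have "\<bar>(f (x + t *\<^sub>R a + t *\<^sub>R b) - f (x + t *\<^sub>R a) - f (x + t *\<^sub>R b) + f x) - t\<^sup>2 * A b\<bar>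
      \<le> \<epsilon> * t\<^sup>2" if t: "0 < t" "t < \<delta>" for t
  proof -
    have tK: "t * K < d" "t * K < \<rho>"
    proof -
      have "t * (K + 1) < min d \<rho>" using t K by (simp add: \<delta>_def pos_less_divide_eq)
      moreover have "t * K \<le> t * (K + 1)" using t by simp
      ultimately show "t * K < d" "t * K < \<rho>" by linarith+
    qed
    have n1: "norm (s *\<^sub>R a + t *\<^sub>R b) \<le> t * K" and n2: "norm (s *\<^sub>R a) \<le> t * K"
      if "0 \<le> s" "s \<le> t" for s
    proof -
      have "norm (s *\<^sub>R a) \<le> t * norm a" using that by (simp add: mult_right_mono)
      moreover have "norm (t *\<^sub>R b) = t * norm b" using t by simp
      ultimately show "norm (s *\<^sub>R a + t *\<^sub>R b) \<le> t * K" "norm (s *\<^sub>R a) \<le> t * K"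
        using norm_triangle_ineq[of "s *\<^sub>R a" "t *\<^sub>R b"] t by (auto simp: K_def algebra_simps
           intro: order_trans)
    qed
    have "\<exists>z>0. z < t \<and>
       (f (x + t *\<^sub>R a + t *\<^sub>R b) - f (x + t *\<^sub>R a)) - (f (x + 0 *\<^sub>R a + t *\<^sub>R b) - f (x + 0 *\<^sub>R a)) =
       (t - 0) * (f' (x + z *\<^sub>R a + t *\<^sub>R b) a - f' (x + z *\<^sub>R a) a)"
    proof (rule MVT2[OF t(1)])
      fix s assume s: "0 \<le> s" "s \<le> t"
      have in_S: "x + s *\<^sub>R a + t *\<^sub>R b \<in> S" "x + s *\<^sub>R a \<in> S"
        using n1[OF s] n2[OF s] tK by (auto intro!: \<rho>(2) simp: add.assoc)
      have "((\<lambda>s. f (x + s *\<^sub>R a + t *\<^sub>R b)) has_derivative (\<lambda>h. f' (x + s *\<^sub>R a + t *\<^sub>R b) (h *\<^sub>R a))) (at s)"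
        by (rule has_derivative_compose[where f = "\<lambda>s. x + s *\<^sub>R a + t *\<^sub>R b" and g = f, OF _ f[OF in_S(1)]]) (auto intro!: derivative_eq_intros)
      moreover have "((\<lambda>s. f (x + s *\<^sub>R a)) has_derivative (\<lambda>h. f' (x + s *\<^sub>R a) (h *\<^sub>R a))) (at s)"
        by (rule has_derivative_compose[where f = "\<lambda>s. x + s *\<^sub>R a" and g = f, OF _ f[OF in_S(2)]]) (auto intro!: derivative_eq_intros)
      ultimately show "((\<lambda>s. f (x + s *\<^sub>R a + t *\<^sub>R b) - f (x + s *\<^sub>R a)) has_real_derivative
          f' (x + s *\<^sub>R a + t *\<^sub>R b) a - f' (x + s *\<^sub>R a) a) (at s)"
        using f[OF in_S(1), THEN has_derivative_bounded_linear]
          f[OF in_S(2), THEN has_derivative_bounded_linear]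
        unfolding has_field_derivative_def
        by (auto intro!: derivative_eq_intros simp: linear_simps algebra_simps)
    qed
    then obtain z where z: "0 < z" "z < t"
      and eq: "f (x + t *\<^sub>R a + t *\<^sub>R b) - f (x + t *\<^sub>R a) - f (x + t *\<^sub>R b) + f x =
        t * (f' (x + z *\<^sub>R a + t *\<^sub>R b) a - f' (x + z *\<^sub>R a) a)"
      by (auto simp: algebra_simps)
    have "\<bar>f' (x + (z *\<^sub>R a + t *\<^sub>R b)) a - f' x a - A (z *\<^sub>R a + t *\<^sub>R b)\<bar> \<le> e * (t * K)"
      using dA[of "x + (z *\<^sub>R a + t *\<^sub>R b)"] n1[of z] z tK e(1)
      by (auto intro: order_trans[OF _ mult_left_mono])
    moreover have "\<bar>f' (x + z *\<^sub>R a) a - f' x a - A (z *\<^sub>R a)\<bar> \<le> e * (t * K)"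
      using dA[of "x + z *\<^sub>R a"] n2[of z] z tK e(1)
      by (auto intro: order_trans[OF _ mult_left_mono])
    moreover have "A (z *\<^sub>R a + t *\<^sub>R b) = A (z *\<^sub>R a) + t * A b" by (simp add: A.add A.scaleR)
    ultimately have "\<bar>(f' (x + z *\<^sub>R a + t *\<^sub>R b) a - f' (x + z *\<^sub>R a) a) - t * A b\<bar> \<le> t * (e * (2 * K))"
      by (simp add: add.assoc algebra_simps)
    also have "\<dots> \<le> t * \<epsilon>" using e(2) t by (intro mult_left_mono) auto
    finally have "t * \<bar>(f' (x + z *\<^sub>R a + t *\<^sub>R b) a - f' (x + z *\<^sub>R a) a) - t * A b\<bar> \<le> t * (t * \<epsilon>)"
      using t by (intro mult_left_mono) auto
    moreover have "t * \<bar>(f' (x + z *\<^sub>R a + t *\<^sub>R b) a - f' (x + z *\<^sub>R a) a) - t * A b\<bar>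
        = \<bar>t * (f' (x + z *\<^sub>R a + t *\<^sub>R b) a - f' (x + z *\<^sub>R a) a) - t\<^sup>2 * A b\<bar>"
      using t by (simp add: abs_mult_pos' right_diff_distrib power2_eq_square mult.assoc)
    ultimately show ?thesis unfolding eq by (simp add: power2_eq_square mult_ac)
  qed
  ultimately show ?thesis by blast
qed

lemma second_derivative_symmetric:
  fixes f :: "'a::real_normed_vector \<Rightarrow> real"
  assumes S: "open S" "x \<in> S" and f: "\<And>y. y \<in> S \<Longrightarrow> (f has_derivative f' y) (at y)"
    and A: "((\<lambda>y. f' y a) has_derivative A) (at x)"
    and B: "((\<lambda>y. f' y b) has_derivative B) (at x)"
  shows "A b = B a"
proof -
  have "\<bar>A b - B a\<bar> \<le> 0 + \<epsilon>" if "\<epsilon> > 0" for \<epsilon>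
  proof -
    have "\<epsilon> / 2 > 0" using that by simp
    from second_difference_quotient[OF S f A this, of b] second_difference_quotient[OF S f B this, of a]
    obtain \<delta>1 \<delta>2 where \<delta>: "\<delta>1 > 0" "\<delta>2 > 0"
      and 1: "\<And>t. 0 < t \<Longrightarrow> t < \<delta>1 \<Longrightarrow>
        \<bar>(f (x + t *\<^sub>R a + t *\<^sub>R b) - f (x + t *\<^sub>R a) - f (x + t *\<^sub>R b) + f x) - t\<^sup>2 * A b\<bar> \<le> \<epsilon> / 2 * t\<^sup>2"
      and 2: "\<And>t. 0 < t \<Longrightarrow> t < \<delta>2 \<Longrightarrow>
        \<bar>(f (x + t *\<^sub>R b + t *\<^sub>R a) - f (x + t *\<^sub>R b) - f (x + t *\<^sub>R a) + f x) - t\<^sup>2 * B a\<bar> \<le> \<epsilon> / 2 * t\<^sup>2"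
      by blast
    define t where "t = min \<delta>1 \<delta>2 / 2"
    have t: "0 < t" "t < \<delta>1" "t < \<delta>2" using \<delta> by (auto simp: t_def)
    have "x + t *\<^sub>R b + t *\<^sub>R a = x + t *\<^sub>R a + t *\<^sub>R b" by (simp add: add_ac)
    then have "\<bar>t\<^sup>2 * A b - t\<^sup>2 * B a\<bar> \<le> \<epsilon> * t\<^sup>2"
      using 1[OF t(1,2)] 2[OF t(1,3)] by (simp only:)
    then have "\<bar>t\<^sup>2 * (A b - B a)\<bar> \<le> \<epsilon> * t\<^sup>2" by (simp only: right_diff_distrib)
    then have "t\<^sup>2 * \<bar>A b - B a\<bar> \<le> t\<^sup>2 * \<epsilon>" by (simp add: abs_mult mult.commute)
    then show ?thesis using t by simp
  qed
  then show ?thesis using field_le_epsilon[of "\<bar>A b - B a\<bar>" 0] by force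
qed

section \<open>Comparison along a line\<close>

text \<open>
  The extremal solutions of \<open>w' = 2 w\<^bsup>3/2\<^esup>\<close> have \<open>1 / sqrt w\<close> affine of slope \<open>-1\<close>; hence
  \<open>1 / sqrt w + s\<close> is nondecreasing.
\<close>

lemma sqrt_le_of_riccati_le:
  fixes w w' :: "real \<Rightarrow> real"
  assumes w: "\<And>s. 0 \<le> s \<Longrightarrow> s \<le> b \<Longrightarrow> (w has_real_derivative w' s) (at s)"
    and pos: "\<And>s. 0 \<le> s \<Longrightarrow> s \<le> b \<Longrightarrow> 0 < w s"
    and w': "\<And>s. 0 \<le> s \<Longrightarrow> s \<le> b \<Longrightarrow> w' s \<le> 2 * sqrt (w s) ^ 3"
    and L: "sqrt (w 0) \<le> L" "L * b < 1" and s: "0 \<le> s" "s \<le> b"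
  shows "sqrt (w s) \<le> L / (1 - L * s)"
proof -
  have "1 / sqrt (w 0) + 0 \<le> 1 / sqrt (w s) + s"
  proof (rule DERIV_nonneg_imp_nondecreasing[OF s(1)])
    fix r assume r: "0 \<le> r" "r \<le> s"
    then have r': "0 \<le> r" "r \<le> b" using s by auto
    have p: "sqrt (w r) > 0" "w r = (sqrt (w r))\<^sup>2" using pos[OF r'] by auto
    have "((\<lambda>r. 1 / sqrt (w r) + r) has_real_derivative
        1 - w' r / (2 * sqrt (w r) ^ 3)) (at r)"
      using p(1) pos[OF r']
      by (auto intro!: derivative_eq_intros w[OF r'] simp: field_simps power2_eq_square power3_eq_cube)
    moreover have "w' r / (2 * sqrt (w r) ^ 3) \<le> 1" using w'[OF r'] p by (simp add: field_simps)
    ultimately show "\<exists>y. ((\<lambda>r. 1 / sqrt (w r) + r) has_real_derivative y) (at r) \<and> 0 \<le> y" by force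
  qed
  moreover have p: "0 < sqrt (w s)" "0 < sqrt (w 0)" using pos s by auto
  moreover from this have "0 < L" using L by linarith
  moreover have "1 / L \<le> 1 / sqrt (w 0)" using p L \<open>0 < L\<close> by (intro divide_left_mono mult_pos_pos) auto
  ultimately have "1 / L - s \<le> 1 / sqrt (w s)" by linarith
  moreover have "L * s < 1" using L s \<open>0 < L\<close> by (meson le_less_trans less_imp_le mult_left_mono)
  ultimately show ?thesis using p \<open>0 < L\<close> by (simp add: field_simps)
qed

lemma sqrt_ge_of_riccati_ge:
  fixes w w' :: "real \<Rightarrow> real"
  assumes w: "\<And>s. 0 \<le> s \<Longrightarrow> s \<le> b \<Longrightarrow> (w has_real_derivative w' s) (at s)"
    and pos: "\<And>s. 0 \<le> s \<Longrightarrow> s \<le> b \<Longrightarrow> 0 < w s"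
    and w': "\<And>s. 0 \<le> s \<Longrightarrow> s \<le> b \<Longrightarrow> - 2 * sqrt (w s) ^ 3 \<le> w' s"
    and s: "0 \<le> s" "s \<le> b"
  shows "sqrt (w 0) / (1 + sqrt (w 0) * s) \<le> sqrt (w s)"
proof -
  have "1 / sqrt (w s) - s \<le> 1 / sqrt (w 0) - 0"
  proof (rule DERIV_nonpos_imp_nonincreasing[OF s(1)])
    fix r assume r: "0 \<le> r" "r \<le> s"
    then have r': "0 \<le> r" "r \<le> b" using s by auto
    have p: "sqrt (w r) > 0" "w r = (sqrt (w r))\<^sup>2" using pos[OF r'] by auto
    have "((\<lambda>r. 1 / sqrt (w r) - r) has_real_derivative
        - 1 - w' r / (2 * sqrt (w r) ^ 3)) (at r)"
      using p(1) pos[OF r']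
      by (auto intro!: derivative_eq_intros w[OF r'] simp: field_simps power2_eq_square power3_eq_cube)
    moreover have "- 1 \<le> w' r / (2 * sqrt (w r) ^ 3)" using w'[OF r'] p by (simp add: field_simps)
    ultimately show "\<exists>y. ((\<lambda>r. 1 / sqrt (w r) - r) has_real_derivative y) (at r) \<and> y \<le> 0" by force
  qed
  moreover have p: "0 < sqrt (w s)" "0 < sqrt (w 0)" using pos s by auto
  ultimately have "1 / sqrt (w s) \<le> (1 + sqrt (w 0) * s) / sqrt (w 0)"
    by (simp add: field_simps)
  moreover have "0 < 1 + sqrt (w 0) * s" using p s by (simp add: add_pos_nonneg)
  ultimately show ?thesis using p by (simp add: field_simps)
qed

text \<open>
  The solution \<open>0\<close> is unique because \<open>w\<close> is bounded on the interval, so that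
  \<open>w' \<le> 2 M w\<close> for a constant \<open>M\<close>. This is what excludes a degenerate Hessian.
\<close>

lemma riccati_zero_propagates:
  fixes w w' :: "real \<Rightarrow> real"
  assumes w: "\<And>s. 0 \<le> s \<Longrightarrow> s \<le> b \<Longrightarrow> (w has_real_derivative w' s) (at s)"
    and nonneg: "\<And>s. 0 \<le> s \<Longrightarrow> s \<le> b \<Longrightarrow> 0 \<le> w s"
    and w': "\<And>s. 0 \<le> s \<Longrightarrow> s \<le> b \<Longrightarrow> w' s \<le> 2 * sqrt (w s) ^ 3"
    and w0: "w 0 = 0" and s: "0 \<le> s" "s \<le> b"
  shows "w s = 0"
proof -
  have "continuous_on {0..b} w"
    using w by (intro continuous_at_imp_continuous_on ballI DERIV_isCont) auto
  then obtain m where m: "m \<in> {0..b}" "\<And>r. r \<in> {0..b} \<Longrightarrow> w r \<le> w m"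
    using continuous_attains_sup[of "{0..b}" w] s by fastforce
  define M where "M = sqrt (w m)"
  have "w s * exp (- (2 * M * s)) \<le> w 0 * exp (- (2 * M * 0))"
  proof (rule DERIV_nonpos_imp_nonincreasing[OF s(1)])
    fix r assume r: "0 \<le> r" "r \<le> s"
    then have r': "0 \<le> r" "r \<le> b" using s by auto
    have "sqrt (w r) ^ 3 = w r * sqrt (w r)"
      using nonneg[OF r'] by (simp add: power3_eq_cube)
    also have "\<dots> \<le> w r * M"
      using m(2)[of r] r' nonneg[OF r'] by (intro mult_left_mono) (auto simp: M_def)
    finally have "w' r - 2 * M * w r \<le> 0" using w'[OF r'] by (simp add: mult_ac)
    moreover have "((\<lambda>r. w r * exp (- (2 * M * r))) has_real_derivative
        (w' r - 2 * M * w r) * exp (- (2 * M * r))) (at r)"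
      by (auto intro!: derivative_eq_intros w[OF r'] simp: algebra_simps)
    ultimately show "\<exists>y. ((\<lambda>r. w r * exp (- (2 * M * r))) has_real_derivative y) (at r) \<and> y \<le> 0"
      by (metis exp_ge_zero mult_nonpos_nonneg)
  qed
  then have "w s \<le> 0" using w0 by (simp add: mult_le_0_iff)
  then show ?thesis using nonneg[OF s] by simp
qed

text \<open>
  If \<open>D\<close> were positive, \<open>f'\<close> would increase to the right of \<open>c\<close>, contradicting the two tangent inequalities
  between \<open>c\<close> and a nearby \<open>c + h\<close>.
\<close>

lemma concave_on_second_derivative_nonpos:
  fixes f f' :: "real \<Rightarrow> real"
  assumes conc: "concave_on I f" and I: "open I" "c \<in> I"
    and f: "\<And>s. s \<in> I \<Longrightarrow> (f has_real_derivative f' s) (at s)"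
    and f': "(f' has_real_derivative D) (at c)"
  shows "D \<le> 0"
proof (rule ccontr)
  assume "\<not> D \<le> 0"
  then obtain e where e: "e > 0" "\<And>h. 0 < h \<Longrightarrow> h < e \<Longrightarrow> f' c < f' (c + h)"
    using DERIV_pos_inc_right[OF f'] by force
  obtain d where d: "d > 0" "\<And>y. \<bar>y - c\<bar> < d \<Longrightarrow> y \<in> I"
    using I by (auto simp: open_dist dist_real_def)
  define h where "h = min d e / 2"
  have h: "0 < h" "h < e" "c + h \<in> I" using d e(1) by (auto simp: h_def intro!: d(2))
  have conv: "convex_on I (\<lambda>s. - f s)" using conc by (simp add: concave_on_def)
  then have con: "connected I" by (intro convex_connected convex_on_imp_convex)
  have tangent: "- f y - - f z \<ge> - f' z * (y - z)" if "y \<in> I" "z \<in> I" for y z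
    using convex_on_imp_above_tangent[OF conv con _ that(1), of z "- f' z"] that
      DERIV_minus[OF f[OF that(2)]] interior_open[OF I(1)]
    by (simp add: has_field_derivative_at_within)
  have "f' (c + h) * h \<le> f' c * h"
    using tangent[OF I(2) h(3)] tangent[OF h(3) I(2)] by (simp add: algebra_simps)
  then show False using e(2)[OF h(1,2)] h(1) by simp
qed

section \<open>Three times differentiable functions\<close>

lemma linear_inner_matrix_vector: "linear (\<lambda>M :: real ^ 'n ^ 'm. u \<bullet> (M *v v))"
  by (rule linearI) (simp_all add: matrix_vector_mult_add_rdistrib inner_right_distrib
      scaleR_matrix_vector_assoc[symmetric])

context
  fixes S :: "(real ^ 'n) set" and f :: "real ^ 'n \<Rightarrow> real"
  assumes S: "open S" and C3: "C3_on S f"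
begin

lemma has_derivative_grad:
  assumes "x \<in> S"
  shows "(f has_derivative (\<lambda>h. grad f x \<bullet> h)) (at x)"
proof -
  have D: "(f has_derivative frechet_derivative f (at x)) (at x)"
    using C3 assms by (simp add: C3_on_def frechet_derivative_works[symmetric])
  then interpret D: linear "frechet_derivative f (at x)" by (rule has_derivative_linear)
  have "frechet_derivative f (at x) h = grad f x \<bullet> h" for h
  proof -
    have "frechet_derivative f (at x) h = frechet_derivative f (at x) (\<Sum>i\<in>UNIV. h $ i *\<^sub>R axis i 1)"
      using basis_expansion[of h] by (simp add: scalar_mult_eq_scaleR)
    also have "\<dots> = grad f x \<bullet> h"
      by (simp add: D.sum D.scale inner_vec_def grad_def mult.commute)
    finally show ?thesis .
  qed
  then show ?thesis using D by (metis (no_types, lifting) ext)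
qed

lemma has_derivative_hess:
  assumes "x \<in> S"
  shows "(grad f has_derivative (\<lambda>h. hess f x *v h)) (at x)"
  using C3 assms unfolding C3_on_def hess_def jacobian_works by blast

lemma has_derivative_dhess:
  assumes "x \<in> S"
  shows "(hess f has_derivative dhess f x) (at x)"
  using C3 assms unfolding C3_on_def frechet_derivative_works dhess_def by simp

lemma has_derivative_inner_grad:
  assumes "x \<in> S"
  shows "((\<lambda>y. u \<bullet> grad f y) has_derivative (\<lambda>h. u \<bullet> (hess f x *v h))) (at x)"
  by (rule has_derivative_inner_right[OF has_derivative_hess[OF assms]])

lemma has_derivative_hess_form:
  assumes "x \<in> S"
  shows "((\<lambda>y. u \<bullet> (hess f y *v v)) has_derivative (\<lambda>h. u \<bullet> (dhess f x h *v v))) (at x)"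
proof -
  have "bounded_linear (\<lambda>M :: real ^ 'n ^ 'n. u \<bullet> (M *v v))"
    using linear_inner_matrix_vector by (simp add: linear_conv_bounded_linear)
  from bounded_linear.has_derivative[OF this has_derivative_dhess[OF assms]] show ?thesis .
qed

lemma hess_symmetric:
  assumes "x \<in> S"
  shows "u \<bullet> (hess f x *v v) = v \<bullet> (hess f x *v u)"
proof -
  have "((\<lambda>y. grad f y \<bullet> w) has_derivative (\<lambda>h. w \<bullet> (hess f x *v h))) (at x)" for w
    using has_derivative_inner_grad[OF assms, of w] by (simp only: inner_commute[of w])
  from second_derivative_symmetric[OF S assms has_derivative_grad this this] show ?thesis .
qed

text \<open>
  The first symmetry differentiates that of the Hessian; the second is the symmetry of the second
  derivative of \<open>y \<mapsto> u \<bullet> grad f y\<close>. Together they allow any permutation of the three directions.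
\<close>

lemma dhess_symmetric: 
  assumes x: "x \<in> S"
  shows "u \<bullet> (dhess f x a *v b) = b \<bullet> (dhess f x a *v u)"
    and "u \<bullet> (dhess f x a *v b) = u \<bullet> (dhess f x b *v a)"
proof -
  have "((\<lambda>y. b \<bullet> (hess f y *v u)) has_derivative (\<lambda>h. u \<bullet> (dhess f x h *v b))) (at x)"
    by (rule has_derivative_transform_within_open[OF has_derivative_hess_form[OF x] S x])
       (rule hess_symmetric)
  then have "(\<lambda>h. u \<bullet> (dhess f x h *v b)) = (\<lambda>h. b \<bullet> (dhess f x h *v u))"
    using has_derivative_hess_form[OF x] by (rule has_derivative_unique)
  then show "u \<bullet> (dhess f x a *v b) = b \<bullet> (dhess f x a *v u)" by meson
  show "u \<bullet> (dhess f x a *v b) = u \<bullet> (dhess f x b *v a)"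
    by (rule second_derivative_symmetric[OF S x has_derivative_inner_grad
          has_derivative_hess_form[OF x] has_derivative_hess_form[OF x]])
qed

lemma deriv_along_line:
  assumes "x + s *\<^sub>R h \<in> S"
  shows "((\<lambda>s. f (x + s *\<^sub>R h)) has_real_derivative grad f (x + s *\<^sub>R h) \<bullet> h) (at s)"
    and "((\<lambda>s. u \<bullet> grad f (x + s *\<^sub>R h)) has_real_derivative u \<bullet> (hess f (x + s *\<^sub>R h) *v h)) (at s)"
    and "((\<lambda>s. u \<bullet> (hess f (x + s *\<^sub>R h) *v v)) has_real_derivative
           u \<bullet> (dhess f (x + s *\<^sub>R h) h *v v)) (at s)"
proof -
  have line: "((\<lambda>s. x + s *\<^sub>R h) has_derivative (\<lambda>r. r *\<^sub>R h)) (at s)"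
    by (auto intro!: derivative_eq_intros)
  have along: "((\<lambda>s. g (x + s *\<^sub>R h)) has_real_derivative G h) (at s)"
    if "(g has_derivative G) (at (x + s *\<^sub>R h))" for g :: "real ^ 'n \<Rightarrow> real" and G
    using has_derivative_compose[OF line that] linear_scale[OF has_derivative_linear[OF that]]
    by (simp add: has_field_derivative_def mult_commute_abs)
  show "((\<lambda>s. f (x + s *\<^sub>R h)) has_real_derivative grad f (x + s *\<^sub>R h) \<bullet> h) (at s)"
    by (rule along[OF has_derivative_grad[OF assms]])
  show "((\<lambda>s. u \<bullet> grad f (x + s *\<^sub>R h)) has_real_derivative u \<bullet> (hess f (x + s *\<^sub>R h) *v h)) (at s)"
    by (rule along[OF has_derivative_inner_grad[OF assms]])
  show "((\<lambda>s. u \<bullet> (hess f (x + s *\<^sub>R h) *v v)) has_real_derivative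
           u \<bullet> (dhess f (x + s *\<^sub>R h) h *v v)) (at s)"
    by (rule along[OF has_derivative_hess_form[OF assms]])
qed

lemma linear_hess_form: "linear (\<lambda>v. u \<bullet> (hess f x *v v))"
  by (rule linearI) (simp_all add: matrix_vector_right_distrib inner_right_distrib
     matrix_vector_mult_scaleR)

lemma dhess_bound:
  assumes x: "x \<in> S" and pos: "\<And>h. h \<noteq> 0 \<Longrightarrow> 0 < h \<bullet> (hess f x *v h)"
    and sc: "\<And>h. h \<bullet> (dhess f x h *v h) \<le> 2 * local_norm f x h ^ 3"
  shows "\<bar>u \<bullet> (dhess f x v *v v)\<bar> \<le> 2 * local_norm f x u * (local_norm f x v)\<^sup>2"
proof -
  let ?B = "\<lambda>a b. a \<bullet> (hess f x *v b)" and ?T = "\<lambda>a b c. a \<bullet> (dhess f x b *v c)"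
  have "\<bar>?T u v v\<bar> \<le> 2 * sqrt (?B u u) * ?B v v"
  proof (rule symmetric_trilinear_bound[where B = ?B and T = ?T])
    show "linear (?B a)" for a by (rule linear_hess_form)
    show "?B a b = ?B b a" for a b by (rule hess_symmetric[OF x])
    show "linear (?T a b)" for a b
      by (rule linearI) (simp_all add: matrix_vector_right_distrib inner_right_distrib
        matrix_vector_mult_scaleR)
    show "?T a b c = ?T b a c" for a b c
      using dhess_symmetric[OF x] by metis
    show "?T a b c = ?T a c b" for a b c by (rule dhess_symmetric(2)[OF x])
    show "?T h h h \<le> 2 * sqrt (?B h h) ^ 3" for h using sc[of h] by (simp add: local_norm_def)
    show "0 < ?B a a" if "a \<noteq> 0" for a by (rule pos[OF that])
  qed simp
  moreover have "0 \<le> ?B v v" using pos[of v] by (cases "v = 0") auto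
  ultimately show ?thesis by (simp add: local_norm_def)
qed

end

section \<open>Self-concordant barriers\<close>

locale self_concordant_barrier_on =
  fixes X :: "(real ^ 'n) set" and F :: "real ^ 'n \<Rightarrow> real" and \<nu> :: real
  assumes compact_X: "compact X" and convex_X: "convex X"
    and barrier_F: "self_concordant_barrier \<nu> X F"
begin

abbreviation (input) H :: "real ^ 'n \<Rightarrow> real ^ 'n \<Rightarrow> real ^ 'n" where "H x h \<equiv> hess F x *v h"
abbreviation (input) D3 :: "real ^ 'n \<Rightarrow> real ^ 'n \<Rightarrow> real ^ 'n \<Rightarrow> real ^ 'n" where "D3 x h k \<equiv> dhess F x h *v k"

lemma nu_pos: "0 < \<nu>" and C3_F: "C3_on (interior X) F"
  and strict_F: "strictly_convex_on (interior X) F"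
  and exp_concave: "concave_on (interior X) (\<lambda>x. exp (- (1 / \<nu>) * F x))"
  and third_order: "x \<in> interior X \<Longrightarrow> h \<bullet> D3 x h h \<le> 2 * local_norm F x h ^ 3"
  using barrier_F by (auto simp: self_concordant_barrier_def barrier_def standard_self_concordant_def)

lemma blow_up: "y \<in> frontier X \<Longrightarrow> filterlim F at_top (at y within interior X)"
  using barrier_F by (auto simp: self_concordant_barrier_def barrier_def)

lemmas along_line = deriv_along_line[OF open_interior C3_F]

lemma line_param: "open {s. x + s *\<^sub>R h \<in> interior X}"
  using open_vimage[OF open_interior, of "\<lambda>s. x + s *\<^sub>R h" X]
  by (simp add: vimage_def continuous_intros)

lemma exp_concave_along_line:
  "concave_on {s. x + s *\<^sub>R h \<in> interior X} (\<lambda>s. exp (- (1 / \<nu>) * F (x + s *\<^sub>R h)))"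
proof -
  let ?G = "\<lambda>x. - exp (- (1 / \<nu>) * F x)"
  have conv: "convex_on (interior X) ?G" using exp_concave by (simp add: concave_on_def)
  have line: "x + ((1 - t) *\<^sub>R a + t *\<^sub>R b) *\<^sub>R h = (1 - t) *\<^sub>R (x + a *\<^sub>R h) + t *\<^sub>R (x + b *\<^sub>R h)"
    for a b t :: real by (simp add: algebra_simps)
  have "convex {s. x + s *\<^sub>R h \<in> interior X}"
    using convexD_alt[OF convex_interior[OF convex_X]] unfolding convex_alt mem_Collect_eq line by blast
  moreover have "?G (x + ((1 - t) *\<^sub>R a + t *\<^sub>R b) *\<^sub>R h) \<le> (1 - t) * ?G (x + a *\<^sub>R h) + t * ?G (x + b *\<^sub>R h)"
    if "0 < t" "t < 1" "x + a *\<^sub>R h \<in> interior X" "x + b *\<^sub>R h \<in> interior X" for t a b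
    unfolding line using convex_onD[OF conv, of t] that by simp
  ultimately show ?thesis unfolding concave_on_def by (intro convex_onI) auto
qed

text \<open>
  The second derivative of \<open>exp (- F / \<nu>)\<close> along the line is a positive multiple of
  \<open>(grad F x \<bullet> h)\<^sup>2 / \<nu> - h \<bullet> H x h\<close>.
\<close>

lemma hess_ge_grad_squared:
  assumes x: "x \<in> interior X"
  shows "(grad F x \<bullet> h)\<^sup>2 \<le> \<nu> * (h \<bullet> H x h)"
proof -
  let ?I = "{s. x + s *\<^sub>R h \<in> interior X}"
  define E where "E s = exp (- (1 / \<nu>) * F (x + s *\<^sub>R h))" for s
  define E' where "E' s = E s * (- (1 / \<nu>) * (h \<bullet> grad F (x + s *\<^sub>R h)))" for s
  have E: "(E has_real_derivative E' s) (at s)" if "s \<in> ?I" for s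
    using DERIV_fun_exp[OF DERIV_cmult[OF along_line(1)[of x s h], of "- (1 / \<nu>)"]] that
    by (simp add: E_def[abs_def] E'_def inner_commute)
  have E_pos: "0 < E 0" by (simp add: E_def)
  have 0: "0 \<in> ?I" using x by simp
  have "(E' has_real_derivative
      E 0 * (- (1 / \<nu>) * (h \<bullet> H x h)) + E' 0 * (- (1 / \<nu>) * (h \<bullet> grad F x))) (at 0)"
    using DERIV_mult'[OF E[OF 0] DERIV_cmult[OF along_line(2)[of x 0 h h], of "- (1 / \<nu>)"]] x
    by (simp add: E'_def[abs_def])
  from _ this have "E 0 * (- (1 / \<nu>) * (h \<bullet> H x h)) + E' 0 * (- (1 / \<nu>) * (h \<bullet> grad F x)) \<le> 0"
    by (rule concave_on_second_derivative_nonpos[OF exp_concave_along_line[of x h, folded E_def] line_param 0])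
       (rule E)
  moreover have "E 0 * (- (1 / \<nu>) * (h \<bullet> H x h)) + E' 0 * (- (1 / \<nu>) * (h \<bullet> grad F x)) =
      - (1 / \<nu>) * (E 0 * (h \<bullet> H x h - (grad F x \<bullet> h)\<^sup>2 / \<nu>))"
    by (simp add: E'_def inner_commute power2_eq_square algebra_simps)
  ultimately have "0 \<le> (1 / \<nu>) * (E 0 * (h \<bullet> H x h - (grad F x \<bullet> h)\<^sup>2 / \<nu>))"
    by simp
  then have "0 \<le> h \<bullet> H x h - (grad F x \<bullet> h)\<^sup>2 / \<nu>"
    using nu_pos E_pos unfolding zero_le_mult_iff by auto
  then show ?thesis using nu_pos by (simp add: field_simps)
qed

lemma hess_psd: "x \<in> interior X \<Longrightarrow> 0 \<le> h \<bullet> H x h"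
  using order_trans[OF zero_le_power2 hess_ge_grad_squared[of x h]] nu_pos
  by (simp add: zero_le_mult_iff)

lemma local_norm_sq: "x \<in> interior X \<Longrightarrow> (local_norm F x h)\<^sup>2 = h \<bullet> H x h"
  and local_norm_nonneg: "x \<in> interior X \<Longrightarrow> 0 \<le> local_norm F x h"
  by (simp_all add: local_norm_def hess_psd)

lemma grad_bound:
  assumes "x \<in> interior X"
  shows "\<bar>grad F x \<bullet> h\<bar> \<le> sqrt \<nu> * local_norm F x h"
proof -
  have "(grad F x \<bullet> h)\<^sup>2 \<le> (sqrt \<nu> * local_norm F x h)\<^sup>2"
    using hess_ge_grad_squared[OF assms] nu_pos by (simp add: power_mult_distrib local_norm_sq[OF assms])
  moreover have "0 \<le> sqrt \<nu> * local_norm F x h" using nu_pos local_norm_nonneg[OF assms] by simp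
  ultimately show ?thesis by (simp add: abs_le_square_iff[symmetric])
qed

text \<open>
  The tangent of the concave function \<open>exp (- F / \<nu>)\<close> at \<open>x\<close> in direction \<open>y - x\<close> vanishes at the
  parameter \<open>\<nu> / (grad F x \<bullet> (y - x))\<close> if this number is positive. The function is positive inside \<open>X\<close>, so this parameter cannot
  be less than 1.
\<close>

lemma grad_gap:
  assumes x: "x \<in> interior X" and y: "y \<in> X"
  shows "grad F x \<bullet> (y - x) \<le> \<nu>"
proof (rule ccontr)
  define a where "a = grad F x \<bullet> (y - x)"
  assume "\<not> ?thesis"
  then have a: "\<nu> < a" by (simp add: a_def)
  define s where "s = \<nu> / a"
  have s: "0 < s" "s < 1" using a nu_pos by (auto simp: s_def)
  define E where "E s = exp (- (1 / \<nu>) * F (x + s *\<^sub>R (y - x)))" for s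
  let ?I = "{s. x + s *\<^sub>R (y - x) \<in> interior X}"
  have "y - (1 - s) *\<^sub>R (y - x) \<in> interior X"
    using mem_interior_convex_shrink[OF convex_X x y, of "1 - s"] s by simp
  then have sI: "s \<in> ?I" by (simp add: algebra_simps)
  have 0: "0 \<in> ?I" using x by simp
  have "(E has_real_derivative - (1 / \<nu>) * E 0 * a) (at 0)"
    using DERIV_fun_exp[OF DERIV_cmult[OF along_line(1)[of x 0 "y - x"], of "- (1 / \<nu>)"]] x
    by (simp add: E_def[abs_def] a_def mult_ac)
  then have d: "((\<lambda>s. - E s) has_real_derivative (1 / \<nu>) * E 0 * a) (at 0 within ?I)"
    using DERIV_minus[of E "- (1 / \<nu>) * E 0 * a" 0] by (simp add: has_field_derivative_at_within)
  have conv: "convex_on ?I (\<lambda>s. - E s)"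
    using exp_concave_along_line[of x "y - x"] by (simp add: concave_on_def E_def)
  have "- E s - - E 0 \<ge> (1 / \<nu>) * E 0 * a * (s - 0)"
    using conv 0 sI d line_param
    by (intro convex_on_imp_above_tangent[where A = ?I])
       (auto simp: interior_open intro: convex_connected convex_on_imp_convex)
  moreover have "(1 / \<nu>) * E 0 * a * (s - 0) = E 0" using a nu_pos by (simp add: s_def)
  ultimately have "E s \<le> 0" by simp
  then show False by (simp add: E_def)
qed

text \<open>
  The parameter \<open>e\<close> is the first one at which the ray leaves the interior; the point reached is on
  the frontier, where the barrier is infinite.
\<close>

lemma blow_up_at_exit:
  assumes x: "x \<in> interior X" and b: "0 \<le> b" "x + b *\<^sub>R h \<notin> interior X"
  shows "\<exists>e>0. e \<le> b \<and> (\<forall>s. 0 \<le> s \<and> s < e \<longrightarrow> x + s *\<^sub>R h \<in> interior X) \<and>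
    (\<forall>K r. r < e \<longrightarrow> (\<exists>s. r < s \<and> s < e \<and> K < F (x + s *\<^sub>R h)))"
proof -
  let ?I = "{s. x + s *\<^sub>R h \<in> interior X}"
  have "compact ({0..b} - ?I)" using line_param by (intro compact_diff) auto
  moreover have "b \<in> {0..b} - ?I" using b by simp
  ultimately obtain e where e: "e \<in> {0..b} - ?I" "\<And>s. s \<in> {0..b} - ?I \<Longrightarrow> e \<le> s"
    using compact_attains_inf[of "{0..b} - ?I"] by blast
  have "e \<noteq> 0" using x e(1) by auto
  then have "0 < e" "e \<le> b" using e(1) by auto
  have inside: "x + s *\<^sub>R h \<in> interior X" if "0 \<le> s" "s < e" for s
  proof (rule ccontr)
    assume "x + s *\<^sub>R h \<notin> interior X"
    then show False using e(2)[of s] that \<open>e \<le> b\<close> by simp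
  qed
  have "h \<noteq> 0" using b x by auto
  have ev: "\<forall>\<^sub>F s in at_left e. x + s *\<^sub>R h \<in> interior X \<and> x + s *\<^sub>R h \<noteq> x + e *\<^sub>R h"
    using eventually_at_left_real[OF \<open>0 < e\<close>]
    by eventually_elim (use inside \<open>h \<noteq> 0\<close> in simp)
  have tend: "((\<lambda>s. x + s *\<^sub>R h) \<longlongrightarrow> x + e *\<^sub>R h) (at_left e)"
    by (intro tendsto_intros)
  have "x + e *\<^sub>R h \<in> closure X"
  proof (rule Lim_in_closed_set[OF closed_closure _ trivial_limit_at_left_real tend])
    show "\<forall>\<^sub>F s in at_left e. x + s *\<^sub>R h \<in> closure X"
      using ev by eventually_elim (use interior_subset closure_subset in blast)
  qed
  then have "x + e *\<^sub>R h \<in> frontier X" using e(1) by (simp add: frontier_def)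
  moreover have "filterlim (\<lambda>s. x + s *\<^sub>R h) (at (x + e *\<^sub>R h) within interior X) (at_left e)"
    unfolding filterlim_at using ev tend by simp
  ultimately have lim: "filterlim (\<lambda>s. F (x + s *\<^sub>R h)) at_top (at_left e)"
    by (rule filterlim_compose[OF blow_up])
  have "\<exists>s. r < s \<and> s < e \<and> K < F (x + s *\<^sub>R h)" if "r < e" for K r
  proof -
    have "\<forall>\<^sub>F s in at_left e. K < F (x + s *\<^sub>R h) \<and> s \<in> {r<..<e}"
      using lim[unfolded filterlim_at_top_dense, rule_format, of K] eventually_at_left_real[OF that]
      by (rule eventually_conj)
    from eventually_happens'[OF trivial_limit_at_left_real this] show ?thesis by auto
  qed
  then show ?thesis using \<open>0 < e\<close> \<open>e \<le> b\<close> inside by (intro exI[of _ e]) simp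
qed


text \<open>
  A ray along which \<open>F\<close> stays bounded up to any candidate exit point has no exit point.
\<close>

lemma segment_inside:
  assumes x: "x \<in> interior X"
    and bd: "\<And>e s. 0 < e \<Longrightarrow> e \<le> b \<Longrightarrow> (\<And>r. 0 \<le> r \<Longrightarrow> r < e \<Longrightarrow> x + r *\<^sub>R h \<in> interior X)
       \<Longrightarrow> 0 \<le> s \<Longrightarrow> s < e \<Longrightarrow> F (x + s *\<^sub>R h) \<le> K"
    and s: "0 \<le> s" "s \<le> b"
  shows "x + s *\<^sub>R h \<in> interior X"
proof (rule ccontr)
  assume "x + s *\<^sub>R h \<notin> interior X"
  from blow_up_at_exit[OF x s(1) this] obtain e where e: "0 < e" "e \<le> s"
    and inside: "\<forall>r. 0 \<le> r \<and> r < e \<longrightarrow> x + r *\<^sub>R h \<in> interior X"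
    and blow: "\<forall>K r. r < e \<longrightarrow> (\<exists>s. r < s \<and> s < e \<and> K < F (x + s *\<^sub>R h))"
    by (elim exE conjE)
  from blow[rule_format, OF e(1), of K] obtain r where r: "0 < r" "r < e" "K < F (x + r *\<^sub>R h)"
    by (elim exE conjE)
  moreover have "F (x + r *\<^sub>R h) \<le> K"
    by (rule bd[OF e(1) _ inside[rule_format]]) (use e s r in simp_all)
  ultimately show False by simp
qed

text \<open>
  Let \<open>f\<close> be \<open>F\<close> along a ray to the boundary, \<open>p = f'\<close> and \<open>w = f''\<close>. Exp-concavity says \<open>p\<^sup>2 / w \<le> \<nu>\<close>, whereas
  self-concordance gives \<open>(p\<^sup>2 / w)' \<ge> 2 p (1 - p / sqrt w) \<ge> 2 (1 - sqrt \<nu>) p\<close> once \<open>p > 0\<close>. If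
  \<open>\<nu> < 1\<close> then \<open>p\<^sup>2 / w\<close> grows at least like a positive multiple of \<open>f\<close>, which tends to infinity.
\<close>

lemma nu_ge_1:
  assumes "interior X \<noteq> {}"
  shows "1 \<le> \<nu>"
proof (rule ccontr)
  assume "\<not> 1 \<le> \<nu>"
  then have \<nu>1: "\<nu> < 1" by simp
  from assms obtain x where x: "x \<in> interior X" by blast
  obtain h :: "real ^ 'n" where "norm h = 1" using vector_choose_size[of 1] by auto
  obtain B where B: "\<And>y. y \<in> X \<Longrightarrow> norm y \<le> B"
    using compact_imp_bounded[OF compact_X] unfolding bounded_iff by blast
  have "norm x \<le> B" using B x interior_subset by blast
  then have b: "0 \<le> B + norm x + 1" using norm_ge_zero[of x] by linarith
  have "x + (B + norm x + 1) *\<^sub>R h \<notin> interior X"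
  proof
    assume "x + (B + norm x + 1) *\<^sub>R h \<in> interior X"
    then have "norm (x + (B + norm x + 1) *\<^sub>R h) \<le> B" using B interior_subset by blast
    moreover have "norm ((B + norm x + 1) *\<^sub>R h) \<le> norm (x + (B + norm x + 1) *\<^sub>R h) + norm x"
      using norm_triangle_ineq4[of "x + (B + norm x + 1) *\<^sub>R h" x] by simp
    ultimately show False using b \<open>norm h = 1\<close> by simp
  qed
  from blow_up_at_exit[OF x b this] obtain e where e: "0 < e"
    and inside: "\<forall>s. 0 \<le> s \<and> s < e \<longrightarrow> x + s *\<^sub>R h \<in> interior X"
    and blow: "\<forall>K r. r < e \<longrightarrow> (\<exists>s. r < s \<and> s < e \<and> K < F (x + s *\<^sub>R h))"
    by (elim exE conjE)
  define f where "f s = F (x + s *\<^sub>R h)" for s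
  define p where "p s = h \<bullet> grad F (x + s *\<^sub>R h)" for s
  define w where "w s = h \<bullet> H (x + s *\<^sub>R h) h" for s
  define w' where "w' s = h \<bullet> D3 (x + s *\<^sub>R h) h h" for s
  have f: "(f has_real_derivative p s) (at s)" and p: "(p has_real_derivative w s) (at s)"
    and w: "(w has_real_derivative w' s) (at s)" and w'_le: "w' s \<le> 2 * sqrt (w s) ^ 3"
    and w_ge: "(p s)\<^sup>2 \<le> \<nu> * w s" and w_nonneg: "0 \<le> w s" if "0 \<le> s" "s < e" for s
  proof -
    have s: "x + s *\<^sub>R h \<in> interior X" using inside that by simp
    show "(f has_real_derivative p s) (at s)"
      using along_line(1)[OF s] by (simp add: f_def[abs_def] p_def inner_commute)
    show "(p has_real_derivative w s) (at s)"
      using along_line(2)[OF s] by (simp add: p_def[abs_def] w_def)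
    show "(w has_real_derivative w' s) (at s)"
      using along_line(3)[OF s] by (simp add: w_def[abs_def] w'_def)
    show "w' s \<le> 2 * sqrt (w s) ^ 3"
      using third_order[OF s] by (simp add: w_def w'_def local_norm_def)
    show "(p s)\<^sup>2 \<le> \<nu> * w s"
      using hess_ge_grad_squared[OF s] by (simp add: w_def p_def inner_commute)
    show "0 \<le> w s" using hess_psd[OF s] by (simp add: w_def)
  qed
  obtain s0 where s0: "0 < s0" "s0 < e" "f 0 < f s0"
    using blow[rule_format, OF e, of "f 0"] unfolding f_def by (elim exE conjE)
  \<comment> \<open>Beyond such a point \<open>z\<close> the slope stays positive by convexity.\<close>
  obtain z where z: "0 < z" "z < s0" "f s0 - f 0 = (s0 - 0) * p z"
    using MVT2[OF s0(1), of f p] f s0 by auto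
  have "0 < s0 * p z" using z s0 by simp
  then have pz: "0 < p z" using s0(1) by (simp only: zero_less_mult_iff) auto
  have p_pos: "0 < p s" if "z \<le> s" "s < e" for s
  proof -
    have "p z \<le> p s"
    proof (rule DERIV_nonneg_imp_nondecreasing[OF that(1)])
      fix r assume "z \<le> r" "r \<le> s"
      then have r: "0 \<le> r" "r < e" using that z by auto
      show "\<exists>y. (p has_real_derivative y) (at r) \<and> 0 \<le> y" using p[OF r] w_nonneg[OF r] by blast
    qed
    then show ?thesis using pz by simp
  qed
  define k where "k = 2 * (1 - sqrt \<nu>)"
  have k: "0 < k" using \<nu>1 nu_pos by (simp add: k_def)
  obtain s where s: "z < s" "s < e" "f z + \<nu> / k < f s"
    using blow[rule_format, of z "f z + \<nu> / k"] z s0 unfolding f_def by auto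
  have "(p z)\<^sup>2 / w z - k * f z \<le> (p s)\<^sup>2 / w s - k * f s"
  proof (rule DERIV_nonneg_imp_nondecreasing[OF less_imp_le[OF s(1)]])
    fix r assume r: "z \<le> r" "r \<le> s"
    then have r': "0 \<le> r" "r < e" and "0 < p r" using z s p_pos[of r] by auto
    then have "0 < (p r)\<^sup>2" by simp
    then have "0 < \<nu> * w r" using w_ge[OF r'] by linarith
    then have wr: "0 < w r" using nu_pos by (simp add: zero_less_mult_iff)
    define q where "q = sqrt (w r)"
    have q: "0 < q" "w r = q\<^sup>2" using wr by (auto simp: q_def)
    have "((\<lambda>s. (p s)\<^sup>2 / w s - k * f s) has_real_derivative
        (2 * p r * w r * w r - (p r)\<^sup>2 * w' r) / (w r * w r) - k * p r) (at r)"
      using wr by (auto intro!: derivative_eq_intros f[OF r'] p[OF r'] w[OF r'])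
    moreover have "0 \<le> (2 * p r * w r * w r - (p r)\<^sup>2 * w' r) / (w r * w r) - k * p r"
    proof -
      have "(p r)\<^sup>2 \<le> (sqrt \<nu> * q)\<^sup>2" using w_ge[OF r'] q nu_pos by (simp add: power_mult_distrib)
      then have pq: "p r \<le> sqrt \<nu> * q" using q nu_pos by (simp add: power2_le_iff_abs_le)
      have "(p r)\<^sup>2 * w' r \<le> (p r)\<^sup>2 * (2 * q ^ 3)"
        using w'_le[OF r'] by (intro mult_left_mono) (auto simp: q_def)
      also have "\<dots> = p r * (2 * q ^ 3) * p r" by (simp add: power2_eq_square)
      also have "\<dots> \<le> p r * (2 * q ^ 3) * (sqrt \<nu> * q)"
        using pq \<open>0 < p r\<close> q by (intro mult_left_mono) auto
      also have "\<dots> = (2 * sqrt \<nu> * p r) * (w r * w r)"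
        by (simp add: q(2) power2_eq_square power3_eq_cube)
      finally have "(p r)\<^sup>2 * w' r / (w r * w r) \<le> 2 * sqrt \<nu> * p r"
        using wr by (simp add: pos_divide_le_eq)
      then show ?thesis using wr by (simp add: diff_divide_distrib k_def algebra_simps)
    qed
    ultimately show "\<exists>y. ((\<lambda>s. (p s)\<^sup>2 / w s - k * f s) has_real_derivative y) (at r) \<and> 0 \<le> y"
      by blast
  qed
  moreover have "0 \<le> (p z)\<^sup>2 / w z" using w_nonneg[of z] z s0 by simp
  moreover have "(p s)\<^sup>2 / w s \<le> \<nu>"
    using w_ge[of s] w_nonneg[of s] nu_pos z s by (cases "w s = 0") (auto simp: pos_divide_le_eq)
  moreover have "\<nu> < k * (f s - f z)" using s(3) k by (simp add: field_simps)
  ultimately show False by (simp add: algebra_simps)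
qed

text \<open>
  If the Hessian form vanishes on \<open>h\<close> at \<open>x\<close>, it vanishes on \<open>h\<close> along a whole segment in direction
  \<open>h\<close>, so \<open>F\<close> is affine there, against strict convexity.
\<close>

lemma hess_pd:
  assumes x: "x \<in> interior X" and "h \<noteq> 0"
  shows "0 < h \<bullet> H x h"
proof (rule ccontr)
  assume "\<not> 0 < h \<bullet> H x h"
  then have null: "h \<bullet> H x h = 0" using hess_psd[OF x, of h] by simp
  have 0: "0 \<in> {s. x + s *\<^sub>R h \<in> interior X}" using x by simp
  obtain b where b: "0 < b" "cball 0 b \<subseteq> {s. x + s *\<^sub>R h \<in> interior X}"
    using line_param[of x h, unfolded open_contains_cball, THEN bspec, OF 0] by (elim exE conjE)
  have inside: "x + s *\<^sub>R h \<in> interior X" if "0 \<le> s" "s \<le> b" for s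
  proof -
    have "s \<in> cball 0 b" using that by (simp add: dist_norm)
    then show ?thesis using b(2) by blast
  qed
  have w0: "h \<bullet> H (x + s *\<^sub>R h) h = 0" if s: "0 \<le> s" "s \<le> b" for s
  proof (rule riccati_zero_propagates[where w = "\<lambda>s. h \<bullet> H (x + s *\<^sub>R h) h"
          and w' = "\<lambda>s. h \<bullet> D3 (x + s *\<^sub>R h) h h" and b = b])
    fix r assume r: "0 \<le> r" "r \<le> b"
    show "((\<lambda>s. h \<bullet> H (x + s *\<^sub>R h) h) has_real_derivative h \<bullet> D3 (x + r *\<^sub>R h) h h) (at r)"
      by (rule along_line(3)[OF inside[OF r]])
    show "0 \<le> h \<bullet> H (x + r *\<^sub>R h) h" by (rule hess_psd[OF inside[OF r]])
    show "h \<bullet> D3 (x + r *\<^sub>R h) h h \<le> 2 * sqrt (h \<bullet> H (x + r *\<^sub>R h) h) ^ 3"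
      using third_order[OF inside[OF r], of h] by (simp add: local_norm_def)
  qed (use null s in simp_all)
  define m where "m = h \<bullet> grad F x"
  have slope: "h \<bullet> grad F (x + s *\<^sub>R h) = m" if s: "0 \<le> s" "s \<le> b" for s
  proof -
    have "\<exists>c. \<forall>r\<in>{0..b}. h \<bullet> grad F (x + r *\<^sub>R h) = c"
    proof (intro has_field_derivative_zero_constant)
      fix r assume "r \<in> {0..b}"
      then have r: "0 \<le> r" "r \<le> b" by auto
      show "((\<lambda>r. h \<bullet> grad F (x + r *\<^sub>R h)) has_real_derivative 0) (at r within {0..b})"
        using along_line(2)[OF inside[OF r], of h] w0[OF r] by (simp add: has_field_derivative_at_within)
    qed simp
    then obtain c where "\<forall>r\<in>{0..b}. h \<bullet> grad F (x + r *\<^sub>R h) = c" ..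
    from bspec[OF this, of s] bspec[OF this, of 0] show ?thesis using s by (simp add: m_def)
  qed
  have "\<exists>c. \<forall>r\<in>{0..b}. F (x + r *\<^sub>R h) - m * r = c"
  proof (intro has_field_derivative_zero_constant)
    fix r assume "r \<in> {0..b}"
    then have r: "0 \<le> r" "r \<le> b" by auto
    have "((\<lambda>r. F (x + r *\<^sub>R h) - m * r) has_real_derivative 0) (at r)"
      using DERIV_diff[OF along_line(1)[OF inside[OF r]] DERIV_cmult_Id[of m]] slope[OF r]
      by (simp add: inner_commute)
    then show "((\<lambda>r. F (x + r *\<^sub>R h) - m * r) has_real_derivative 0) (at r within {0..b})"
      by (rule has_field_derivative_at_within)
  qed simp
  then obtain c where c: "\<forall>r\<in>{0..b}. F (x + r *\<^sub>R h) - m * r = c" ..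
  have "x \<noteq> x + b *\<^sub>R h" using b \<open>h \<noteq> 0\<close> by simp
  then have "F ((1 - 1 / 2) *\<^sub>R x + (1 / 2) *\<^sub>R (x + b *\<^sub>R h)) < (1 - 1 / 2) * F x + 1 / 2 * F (x + b *\<^sub>R h)"
    using b(1) by (intro strict_F[unfolded strictly_convex_on_def, THEN conjunct2, rule_format] x inside) simp_all
  moreover have "(1 - 1 / 2) *\<^sub>R x + (1 / 2) *\<^sub>R (x + b *\<^sub>R h) = x + (b / 2) *\<^sub>R h"
    by (simp add: vec_eq_iff field_simps)
  moreover have "F x = c" using bspec[OF c, of 0] b(1) by simp
  moreover have "F (x + (b / 2) *\<^sub>R h) = m * b / 2 + c" using bspec[OF c, of "b / 2"] b(1) by simp
  moreover have "F (x + b *\<^sub>R h) = m * b + c" using bspec[OF c, of b] b(1) by simp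
  ultimately show False by (simp add: field_simps)
qed

lemma third_order_mixed:
  "x \<in> interior X \<Longrightarrow> \<bar>u \<bullet> D3 x v v\<bar> \<le> 2 * local_norm F x u * (local_norm F x v)\<^sup>2"
  by (rule dhess_bound[OF open_interior C3_F _ hess_pd third_order])

section \<open>Local norms along a segment and the Newton step\<close>

lemma local_norm_along_le:
  assumes inside: "\<And>s. 0 \<le> s \<Longrightarrow> s \<le> b \<Longrightarrow> x + s *\<^sub>R h \<in> interior X"
    and L: "local_norm F x h \<le> L" "L * b < 1" and s: "0 \<le> s" "s \<le> b"
  shows "local_norm F (x + s *\<^sub>R h) h \<le> L / (1 - L * s)"
proof (cases "h = 0")
  case True
  then have "0 \<le> L" using L(1) by (simp add: local_norm_def)
  then have "L * s \<le> L * b" using s by (intro mult_left_mono) auto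
  then show ?thesis using True L \<open>0 \<le> L\<close> by (simp add: local_norm_def)
next
  case False
  show ?thesis
    unfolding local_norm_def
  proof (rule sqrt_le_of_riccati_le[where w = "\<lambda>s. h \<bullet> H (x + s *\<^sub>R h) h"
        and w' = "\<lambda>s. h \<bullet> D3 (x + s *\<^sub>R h) h h" and b = b])
    fix r assume r: "0 \<le> r" "r \<le> b"
    show "((\<lambda>s. h \<bullet> H (x + s *\<^sub>R h) h) has_real_derivative h \<bullet> D3 (x + r *\<^sub>R h) h h) (at r)"
      by (rule along_line(3)[OF inside[OF r]])
    show "0 < h \<bullet> H (x + r *\<^sub>R h) h" by (rule hess_pd[OF inside[OF r] False])
    show "h \<bullet> D3 (x + r *\<^sub>R h) h h \<le> 2 * sqrt (h \<bullet> H (x + r *\<^sub>R h) h) ^ 3"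
      using third_order[OF inside[OF r], of h] by (simp add: local_norm_def)
  qed (use L s in \<open>simp_all add: local_norm_def\<close>)
qed

lemma local_norm_along_ge:
  assumes inside: "\<And>s. 0 \<le> s \<Longrightarrow> s \<le> b \<Longrightarrow> x + s *\<^sub>R h \<in> interior X"
    and s: "0 \<le> s" "s \<le> b"
  shows "local_norm F x h / (1 + local_norm F x h * s) \<le> local_norm F (x + s *\<^sub>R h) h"
proof (cases "h = 0")
  case True
  then show ?thesis by (simp add: local_norm_def)
next
  case False
  have "sqrt (h \<bullet> H (x + 0 *\<^sub>R h) h) / (1 + sqrt (h \<bullet> H (x + 0 *\<^sub>R h) h) * s)
      \<le> sqrt (h \<bullet> H (x + s *\<^sub>R h) h)"
  proof (rule sqrt_ge_of_riccati_ge[where w = "\<lambda>s. h \<bullet> H (x + s *\<^sub>R h) h"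
        and w' = "\<lambda>s. h \<bullet> D3 (x + s *\<^sub>R h) h h" and b = b])
    fix r assume r: "0 \<le> r" "r \<le> b"
    show "((\<lambda>s. h \<bullet> H (x + s *\<^sub>R h) h) has_real_derivative h \<bullet> D3 (x + r *\<^sub>R h) h h) (at r)"
      by (rule along_line(3)[OF inside[OF r]])
    show "0 < h \<bullet> H (x + r *\<^sub>R h) h" by (rule hess_pd[OF inside[OF r] False])
    have "\<bar>h \<bullet> D3 (x + r *\<^sub>R h) h h\<bar> \<le> 2 * sqrt (h \<bullet> H (x + r *\<^sub>R h) h) ^ 3"
      using third_order_mixed[OF inside[OF r], of h h]
      by (simp add: local_norm_def power2_eq_square power3_eq_cube mult_ac)
    then show "- 2 * sqrt (h \<bullet> H (x + r *\<^sub>R h) h) ^ 3 \<le> h \<bullet> D3 (x + r *\<^sub>R h) h h" by simp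
  qed (use s in simp_all)
  then show ?thesis by (simp add: local_norm_def)
qed

text \<open>
  Integrate the lower bound \<open>(r / (1 + r s))\<^sup>2\<close> for the second derivative along the line.
\<close>

lemma grad_along_ge:
  fixes x h
  defines "r \<equiv> local_norm F x h"
  assumes inside: "\<And>s. 0 \<le> s \<Longrightarrow> s \<le> b \<Longrightarrow> x + s *\<^sub>R h \<in> interior X"
    and s: "0 \<le> s" "s \<le> b"
  shows "grad F x \<bullet> h + r\<^sup>2 * s / (1 + r * s) \<le> grad F (x + s *\<^sub>R h) \<bullet> h"
proof -
  have r: "0 \<le> r" using local_norm_nonneg[of x h] inside[of 0] s by (simp add: r_def)
  let ?p = "\<lambda>s. h \<bullet> grad F (x + s *\<^sub>R h) - r\<^sup>2 * s / (1 + r * s)"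
  have "?p 0 \<le> ?p s"
  proof (rule DERIV_nonneg_imp_nondecreasing[OF s(1)])
    fix q assume "0 \<le> q" "q \<le> s"
    then have q: "0 \<le> q" "q \<le> b" using s by auto
    have rq: "0 < 1 + r * q" using r q by (simp add: add_pos_nonneg)
    have "(?p has_real_derivative h \<bullet> H (x + q *\<^sub>R h) h
        - (r\<^sup>2 * (1 + r * q) - r\<^sup>2 * q * r) / ((1 + r * q) * (1 + r * q))) (at q)"
      using rq by (auto intro!: derivative_eq_intros along_line(2)[OF inside[OF q]])
    moreover have "(r\<^sup>2 * (1 + r * q) - r\<^sup>2 * q * r) / ((1 + r * q) * (1 + r * q)) = (r / (1 + r * q))\<^sup>2"
      by (simp add: power_divide power2_eq_square algebra_simps)
    moreover have "(r / (1 + r * q))\<^sup>2 \<le> (local_norm F (x + q *\<^sub>R h) h)\<^sup>2"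
      using local_norm_along_ge[OF inside q] r rq by (intro power_mono) (auto simp: r_def)
    ultimately show "\<exists>y. (?p has_real_derivative y) (at q) \<and> 0 \<le> y"
      using local_norm_sq[OF inside[OF q], of h] by (intro exI conjI) auto
  qed
  then show ?thesis by (simp add: inner_commute)
qed

text \<open>
  The open unit ball of the local norm at \<open>x\<close> lies in the interior of \<open>X\<close>: as long as the segment is
  inside, its local length is at most \<open>L / (1 - L)\<close>, so \<open>F\<close> stays bounded and the segment cannot
  reach the frontier.
\<close>

lemma dikin_segment:
  assumes x: "x \<in> interior X" and L: "local_norm F x h \<le> L" "L < 1" and s: "0 \<le> s" "s \<le> 1"
  shows "x + s *\<^sub>R h \<in> interior X"
proof -
  define M where "M = L / (1 - L)"
  define m where "m = h \<bullet> grad F x"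
  have L0: "0 \<le> L" using local_norm_nonneg[OF x, of h] L by simp
  show ?thesis
  proof (rule segment_inside[where b = 1 and K = "F x + (\<bar>m\<bar> + M\<^sup>2)"])
    fix e s assume e: "0 < e" "e \<le> 1" and s: "0 \<le> s" "s < e"
      and inside: "\<And>r. 0 \<le> r \<Longrightarrow> r < e \<Longrightarrow> x + r *\<^sub>R h \<in> interior X"
    have in_s: "x + r *\<^sub>R h \<in> interior X" if "0 \<le> r" "r \<le> s" for r using inside that s by auto
    have curv: "h \<bullet> H (x + r *\<^sub>R h) h \<le> M\<^sup>2" if r: "0 \<le> r" "r \<le> s" for r
    proof -
      have Lr: "L * s \<le> L * 1" "L * r \<le> L * 1" using L0 r s e by (intro mult_left_mono; simp)+
      then have "local_norm F (x + r *\<^sub>R h) h \<le> L / (1 - L * r)"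
        using L by (intro local_norm_along_le[OF in_s]) (use r in auto)
      also have "\<dots> \<le> M" using Lr L L0 unfolding M_def by (intro divide_left_mono mult_pos_pos) auto
      finally show ?thesis
        using local_norm_nonneg[OF in_s[OF r]] local_norm_sq[OF in_s[OF r], of h]
        by (metis power_mono)
    qed
    have slope: "h \<bullet> grad F (x + r *\<^sub>R h) \<le> \<bar>m\<bar> + M\<^sup>2" if r: "0 \<le> r" "r \<le> s" for r
    proof -
      have "h \<bullet> grad F (x + r *\<^sub>R h) - M\<^sup>2 * r \<le> h \<bullet> grad F (x + 0 *\<^sub>R h) - M\<^sup>2 * 0"
      proof (rule DERIV_nonpos_imp_nonincreasing[OF r(1)])
        fix q assume "0 \<le> q" "q \<le> r"
        then have q: "0 \<le> q" "q \<le> s" using r by auto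
        have "((\<lambda>r. h \<bullet> grad F (x + r *\<^sub>R h) - M\<^sup>2 * r) has_real_derivative
            h \<bullet> H (x + q *\<^sub>R h) h - M\<^sup>2) (at q)"
          by (auto intro!: derivative_eq_intros along_line(2)[OF in_s[OF q]])
        then show "\<exists>y. ((\<lambda>r. h \<bullet> grad F (x + r *\<^sub>R h) - M\<^sup>2 * r) has_real_derivative y) (at q) \<and> y \<le> 0"
          using curv[OF q] by (intro exI conjI) auto
      qed
      moreover have "M\<^sup>2 * r \<le> M\<^sup>2 * 1" using r s e by (intro mult_left_mono) auto
      ultimately show ?thesis by (simp add: m_def)
    qed
    have "F (x + s *\<^sub>R h) - (\<bar>m\<bar> + M\<^sup>2) * s \<le> F (x + 0 *\<^sub>R h) - (\<bar>m\<bar> + M\<^sup>2) * 0"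
    proof (rule DERIV_nonpos_imp_nonincreasing[OF s(1)])
      fix q assume q: "0 \<le> q" "q \<le> s"
      have "((\<lambda>r. F (x + r *\<^sub>R h) - (\<bar>m\<bar> + M\<^sup>2) * r) has_real_derivative
          grad F (x + q *\<^sub>R h) \<bullet> h - (\<bar>m\<bar> + M\<^sup>2)) (at q)"
        by (auto intro!: derivative_eq_intros along_line(1)[OF in_s[OF q]])
      then show "\<exists>y. ((\<lambda>r. F (x + r *\<^sub>R h) - (\<bar>m\<bar> + M\<^sup>2) * r) has_real_derivative y) (at q) \<and> y \<le> 0"
        using slope[OF q] by (intro exI conjI) (auto simp: inner_commute)
    qed
    moreover have "(\<bar>m\<bar> + M\<^sup>2) * s \<le> (\<bar>m\<bar> + M\<^sup>2) * 1" using s e by (intro mult_left_mono) auto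
    ultimately show "F (x + s *\<^sub>R h) \<le> F x + (\<bar>m\<bar> + M\<^sup>2)" by simp
  qed (use x s in auto)
qed

text \<open>
  The square \<open>V\<close> of the local norm of a fixed vector \<open>u\<close> satisfies \<open>\<bar>V'\<bar> \<le> 2 L V / (1 - L s)\<close>, so
  \<open>V / (1 - L s)\<^sup>2\<close> is nondecreasing. It is compared with its value at the end of the step, since
  that is the norm in which the new decrement is measured.
\<close>

lemma local_norm_backwards:
  assumes inside: "\<And>s. 0 \<le> s \<Longrightarrow> s \<le> 1 \<Longrightarrow> x + s *\<^sub>R h \<in> interior X"
    and L: "local_norm F x h \<le> L" "L < 1" and s: "0 \<le> s" "s \<le> 1"
  shows "local_norm F (x + s *\<^sub>R h) u \<le> (1 - L * s) / (1 - L) * local_norm F (x + h) u"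
proof -
  have L0: "0 \<le> L" using local_norm_nonneg[of x h] inside[of 0] L by simp
  let ?V = "\<lambda>s. u \<bullet> H (x + s *\<^sub>R h) u"
  have Lr: "0 < 1 - L * r" if "0 \<le> r" "r \<le> 1" for r
    using mult_left_mono[OF that(2) L0] L by simp
  have "?V s / (1 - L * s)\<^sup>2 \<le> ?V 1 / (1 - L * 1)\<^sup>2"
  proof (rule DERIV_nonneg_imp_nondecreasing[OF s(2)])
    fix r assume r: "s \<le> r" "r \<le> 1"
    then have r': "0 \<le> r" using s by simp
    note in_r = inside[OF r' r(2)]
    define q where "q = 1 - L * r"
    have q: "0 < q" using Lr[OF r' r(2)] by (simp add: q_def)
    have "((\<lambda>s. ?V s / (1 - L * s)\<^sup>2) has_real_derivative
       (u \<bullet> D3 (x + r *\<^sub>R h) h u * (1 - L * r)\<^sup>2 - ?V r * (2 * (1 - L * r) * - L)) / ((1 - L * r)\<^sup>2 * (1 - L * r)\<^sup>2)) (at r)"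
      using q by (auto intro!: derivative_eq_intros along_line(3)[OF in_r] simp: q_def)
    moreover have "0 \<le> u \<bullet> D3 (x + r *\<^sub>R h) h u * q\<^sup>2 - ?V r * (2 * q * - L)"
    proof -
      have "u \<bullet> D3 (x + r *\<^sub>R h) h u = h \<bullet> D3 (x + r *\<^sub>R h) u u"
        using dhess_symmetric[OF open_interior C3_F in_r] by metis
      then have "- (2 * local_norm F (x + r *\<^sub>R h) h * ?V r) \<le> u \<bullet> D3 (x + r *\<^sub>R h) h u"
        using third_order_mixed[OF in_r, of h u] local_norm_sq[OF in_r, of u] by simp
      moreover have "local_norm F (x + r *\<^sub>R h) h * ?V r \<le> L / q * ?V r"
        using local_norm_along_le[OF inside L(1) _ r' r(2)] L hess_psd[OF in_r, of u]
        by (intro mult_right_mono) (auto simp: q_def)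
      ultimately have "- (2 * (L / q * ?V r)) \<le> u \<bullet> D3 (x + r *\<^sub>R h) h u" by linarith
      then have "- (2 * (L / q * ?V r)) * q\<^sup>2 \<le> u \<bullet> D3 (x + r *\<^sub>R h) h u * q\<^sup>2"
        by (rule mult_right_mono) simp
      moreover have "- (2 * (L / q * ?V r)) * q\<^sup>2 = ?V r * (2 * q * - L)"
        using q by (simp add: power2_eq_square)
      ultimately show ?thesis by simp
    qed
    ultimately show "\<exists>y. ((\<lambda>s. ?V s / (1 - L * s)\<^sup>2) has_real_derivative y) (at r) \<and> 0 \<le> y"
      unfolding q_def by (intro exI conjI) (assumption, simp)
  qed
  then have "?V s \<le> (1 - L * s)\<^sup>2 / (1 - L)\<^sup>2 * ?V 1"
    using Lr[OF s] L by (simp add: field_simps)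
  then have "sqrt (?V s) \<le> sqrt ((1 - L * s)\<^sup>2 / (1 - L)\<^sup>2 * ?V 1)" by simp
  also have "\<dots> = (1 - L * s) / (1 - L) * sqrt (?V 1)"
    using Lr[OF s] L by (simp add: real_sqrt_mult real_sqrt_divide)
  finally show ?thesis by (simp add: local_norm_def)
qed

text \<open>
  Let \<open>g(s) = u \<bullet> (v + grad F (x + s h))\<close>. The Newton equation says \<open>g(0) + g'(0) = 0\<close>, hence
  \<open>g(1)\<close> is the integral of \<open>(1 - s) g''(s)\<close>, and \<open>g''(s) = D\<^sup>3F[u,h,h]\<close> is at most
  \<open>2 \<parallel>u\<parallel> \<parallel>h\<parallel>\<^sup>2\<close> with norms at \<open>x + s h\<close>. One of the two factors \<open>1 / (1 - L s)\<close> from \<open>\<parallel>h\<parallel>\<^sup>2\<close>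
  cancels against \<open>\<parallel>u\<parallel>\<close>, which is where the estimate gains over \<open>(L / (1 - L))\<^sup>2\<close>.
\<close>

lemma newton_step:
  assumes x: "x \<in> interior X" and L: "local_norm F x h \<le> L" "L < 1"
    and newton: "\<And>u. u \<bullet> (v + grad F x) = - (u \<bullet> H x h)"
  shows "u \<bullet> (v + grad F (x + h)) \<le> L\<^sup>2 * (3 - 2 * L) / (3 * (1 - L)\<^sup>2) * local_norm F (x + h) u"
proof -
  have inside: "x + s *\<^sub>R h \<in> interior X" if "0 \<le> s" "s \<le> 1" for s
    using dikin_segment[OF x L that] .
  have L0: "0 \<le> L" using local_norm_nonneg[OF x, of h] L by simp
  define N where "N = local_norm F (x + h) u"
  have N: "0 \<le> N" using local_norm_nonneg[of "x + h" u] inside[of 1] by (simp add: N_def)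
  define \<kappa> where "\<kappa> = L / (1 - L)"
  have \<kappa>: "0 \<le> \<kappa>" using L L0 by (simp add: \<kappa>_def)
  define C where "C = 2 * N * (L\<^sup>2 / (1 - L))"
  have C: "0 \<le> C" using N L by (simp add: C_def)
  \<comment> \<open>The derivative of \<open>\<phi>\<close> is \<open>(1 - s) g''(s)\<close>; convexity of \<open>1 / (1 - L s)\<close> on the unit interval
    bounds it by \<open>1 + \<kappa> s\<close>, so that the comparison function is a polynomial.\<close>
  define \<phi> where "\<phi> s = (1 - s) * (u \<bullet> H (x + s *\<^sub>R h) h) + u \<bullet> (v + grad F (x + s *\<^sub>R h))" for s
  let ?d = "\<lambda>s. \<phi> s - C * (s - s\<^sup>2 / 2 + \<kappa> * (s\<^sup>2 / 2 - s ^ 3 / 3))"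
  have "?d 1 \<le> ?d 0"
  proof (rule DERIV_nonpos_imp_nonincreasing[of 0 1 ?d])
    fix s :: real assume s: "0 \<le> s" "s \<le> 1"
    note in_s = inside[OF s]
    have Ls: "0 < 1 - L * s" using mult_left_mono[OF s(2) L0] L by simp
    have "(\<phi> has_real_derivative (1 - s) * (u \<bullet> D3 (x + s *\<^sub>R h) h h)) (at s)"
      unfolding \<phi>_def[abs_def] inner_add_right
      by (auto intro!: derivative_eq_intros along_line[OF in_s])
    then have "(?d has_real_derivative (1 - s) * (u \<bullet> D3 (x + s *\<^sub>R h) h h)
        - C * (1 - s + \<kappa> * (s - s\<^sup>2))) (at s)"
      by (auto intro!: derivative_eq_intros simp: power2_eq_square)
    moreover have "(1 - s) * (u \<bullet> D3 (x + s *\<^sub>R h) h h) \<le> C * (1 - s + \<kappa> * (s - s\<^sup>2))"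
    proof -
      have "u \<bullet> D3 (x + s *\<^sub>R h) h h \<le> 2 * local_norm F (x + s *\<^sub>R h) u * (local_norm F (x + s *\<^sub>R h) h)\<^sup>2"
        using third_order_mixed[OF in_s, of u h] by simp
      also have "\<dots> \<le> 2 * ((1 - L * s) / (1 - L) * N) * (L / (1 - L * s))\<^sup>2"
      proof -
        have "local_norm F (x + s *\<^sub>R h) u \<le> (1 - L * s) / (1 - L) * N"
          unfolding N_def by (rule local_norm_backwards[OF inside L s])
        moreover have "local_norm F (x + s *\<^sub>R h) h \<le> L / (1 - L * s)"
          using L s by (intro local_norm_along_le[OF inside, of 1]) auto
        ultimately show ?thesis
          using local_norm_nonneg[OF in_s] N L Ls by (intro mult_mono[OF mult_left_mono power_mono]) auto
      qed
      also have "\<dots> = C * (1 / (1 - L * s))"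
        using L Ls by (simp add: C_def power2_eq_square)
      also have "\<dots> \<le> C * (1 + \<kappa> * s)"
      proof (rule mult_left_mono[OF _ C])
        have "(1 + \<kappa> * s) * (1 - L * s) - 1 = \<kappa> * L * (s * (1 - s))"
          using L by (simp add: \<kappa>_def field_simps)
        moreover have "0 \<le> \<kappa> * L * (s * (1 - s))" using \<kappa> L0 s by simp
        ultimately show "1 / (1 - L * s) \<le> 1 + \<kappa> * s" using Ls by (simp add: pos_divide_le_eq)
      qed
      finally have "(1 - s) * (u \<bullet> D3 (x + s *\<^sub>R h) h h) \<le> (1 - s) * (C * (1 + \<kappa> * s))"
        using s by (intro mult_left_mono) auto
      then show ?thesis by (simp add: power2_eq_square algebra_simps)
    qed
    ultimately show "\<exists>y. (?d has_real_derivative y) (at s) \<and> y \<le> 0" by (intro exI conjI) auto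
  qed simp
  then have "\<phi> 1 \<le> \<phi> 0 + C * (1 / 2 + \<kappa> / 6)" by simp
  moreover have "\<phi> 0 = 0" using newton[of u] by (simp add: \<phi>_def)
  moreover have "\<phi> 1 = u \<bullet> (v + grad F (x + h))" by (simp add: \<phi>_def)
  moreover have "C * (1 / 2 + \<kappa> / 6) = L\<^sup>2 * (3 - 2 * L) / (3 * (1 - L)\<^sup>2) * N"
    using L by (simp add: C_def \<kappa>_def divide_simps power2_eq_square) (simp add: algebra_simps)
  ultimately show ?thesis by (simp add: N_def)
qed

section \<open>Linear algebra of the Newton decrement\<close>

lemma hess_matrix_inv:
  assumes x: "x \<in> interior X"
  shows "H x (matrix_inv (hess F x) *v g) = g"
proof -
  have "inj ((*v) (hess F x))"
  proof (rule injI)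
    fix u v assume "H x u = H x v"
    then have "(u - v) \<bullet> H x (u - v) = 0" by (simp add: matrix_vector_mult_diff_distrib)
    then show "u = v" using hess_pd[OF x, of "u - v"] by (cases "u - v = 0") auto
  qed
  then have "invertible (hess F x)" by (simp add: invertible_left_inverse matrix_left_invertible_injective)
  then have "hess F x ** matrix_inv (hess F x) = mat 1"
    unfolding invertible_def matrix_inv_def by (rule someI2_ex) (rule conjunct1)
  then show ?thesis by (simp add: matrix_vector_mul_assoc)
qed

lemma hess_Cauchy_Schwarz:
  assumes x: "x \<in> interior X"
  shows "u \<bullet> H x v \<le> local_norm F x u * local_norm F x v"
proof (cases "u = 0 \<or> v = 0")
  case True
  then show ?thesis by (auto simp: local_norm_def)
next
  case False
  define a where "a = local_norm F x u"
  define b where "b = local_norm F x v"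
  have ab: "0 < a" "0 < b" using hess_pd[OF x] False by (auto simp: a_def b_def local_norm_def)
  have sym: "v \<bullet> H x u = u \<bullet> H x v" by (rule hess_symmetric[OF open_interior C3_F x])
  have "0 \<le> (b *\<^sub>R u - a *\<^sub>R v) \<bullet> H x (b *\<^sub>R u - a *\<^sub>R v)" by (rule hess_psd[OF x])
  also have "\<dots> = b * b * (u \<bullet> H x u) - 2 * a * b * (u \<bullet> H x v) + a * a * (v \<bullet> H x v)"
    by (simp add: matrix_vector_mult_diff_distrib matrix_vector_mult_scaleR inner_diff_left
        inner_diff_right sym algebra_simps)
  also have "\<dots> = 2 * (a * b) * (a * b - u \<bullet> H x v)"
    unfolding local_norm_sq[OF x, symmetric] a_def[symmetric] b_def[symmetric]
    by (simp add: power2_eq_square algebra_simps)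
  finally have "0 \<le> a * b - u \<bullet> H x v"
    using mult_pos_pos[OF ab] by (simp add: zero_le_mult_iff)
  then show ?thesis by (simp add: a_def b_def)
qed

lemma newton_direction:
  assumes x: "x \<in> interior X" and "0 \<le> L" and g: "\<And>u. u \<bullet> g \<le> L * local_norm F x u"
  shows "local_norm F x (- (matrix_inv (hess F x) *v g)) \<le> L"
proof -
  define d where "d = matrix_inv (hess F x) *v g"
  define r where "r = local_norm F x d"
  have "r * r = d \<bullet> g"
    using local_norm_sq[OF x, of d] hess_matrix_inv[OF x, of g] by (simp add: r_def d_def power2_eq_square)
  then have "r * r \<le> L * r" using g[of d] by (simp add: r_def)
  then have "r \<le> L" using \<open>0 \<le> L\<close> local_norm_nonneg[OF x, of d] by (cases "r = 0") (auto simp: r_def)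
  moreover have "local_norm F x (- d) = r"
    by (simp add: r_def local_norm_def linear_neg[OF matrix_vector_mul_linear])
  ultimately show ?thesis by (simp add: d_def)
qed

text \<open>
  The supremum that defines the dual norm is a genuine one: by the Cauchy-Schwarz inequality it is
  bounded by the local norm of the Newton direction of \<open>g\<close>.
\<close>

lemma inner_le_dual_local_norm:
  assumes x: "x \<in> interior X"
  shows "u \<bullet> g \<le> dual_local_norm F x g * local_norm F x u"
proof (cases "u = 0")
  case True
  then show ?thesis by (simp add: local_norm_def)
next
  case False
  define r where "r = local_norm F x u"
  have r: "0 < r" using hess_pd[OF x False] by (simp add: r_def local_norm_def)
  define d where "d = matrix_inv (hess F x) *v g"
  have "bdd_above ((\<lambda>h. g \<bullet> h) ` {h. local_norm F x h \<le> 1})"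
  proof (rule bdd_aboveI2)
    fix h assume "h \<in> {h. local_norm F x h \<le> 1}"
    then have "local_norm F x h * local_norm F x d \<le> 1 * local_norm F x d"
      using local_norm_nonneg[OF x] by (intro mult_right_mono) auto
    then show "g \<bullet> h \<le> local_norm F x d"
      using hess_Cauchy_Schwarz[OF x, of h d] hess_matrix_inv[OF x, of g] by (simp add: d_def inner_commute)
  qed
  moreover have "local_norm F x ((1 / r) *\<^sub>R u) = 1"
    using r by (simp add: local_norm_def matrix_vector_mult_scaleR real_sqrt_mult real_sqrt_divide r_def)
  ultimately have "g \<bullet> ((1 / r) *\<^sub>R u) \<le> dual_local_norm F x g"
    unfolding dual_local_norm_def by (intro cSUP_upper) auto
  then show ?thesis using r by (simp add: r_def inner_commute field_simps)
qed

lemma grad_penalized: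
  assumes x: "x \<in> interior X"
  shows "grad (penalized c F t) x = t *\<^sub>R c + grad F x"
proof -
  have "(penalized c F t has_derivative (\<lambda>h. t * (c \<bullet> h) + grad F x \<bullet> h)) (at x)"
    unfolding penalized_def[abs_def]
    by (intro derivative_intros has_derivative_grad[OF open_interior C3_F x])
  from frechet_derivative_at[OF this, symmetric] show ?thesis
    by (simp add: grad_def[of "penalized c F t"] vec_eq_iff inner_axis)
qed

lemma hess_penalized:
  assumes x: "x \<in> interior X"
  shows "hess (penalized c F t) x = hess F x"
proof -
  have "((\<lambda>x. t *\<^sub>R c + grad F x) has_derivative (\<lambda>h. H x h)) (at x)"
    using has_derivative_add[OF has_derivative_const[of "t *\<^sub>R c"] has_derivative_hess[OF open_interior C3_F x]]
    by simp
  then have "(grad (penalized c F t) has_derivative (\<lambda>h. H x h)) (at x)"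
    by (rule has_derivative_transform_within_open[OF _ open_interior x]) (simp add: grad_penalized)
  from frechet_derivative_at[OF this, symmetric] show ?thesis
    by (simp add: hess_def[of "penalized c F t"] jacobian_def)
qed

lemma newton_decrement_penalized:
  assumes x: "x \<in> interior X"
  shows "newton_decrement (penalized c F t) x = dual_local_norm F x (t *\<^sub>R c + grad F x)"
  by (simp add: newton_decrement_def dual_local_norm_def local_norm_def grad_penalized[OF x] hess_penalized[OF x])

lemma path_following_step:
  assumes x: "x \<in> interior X"
    and close: "\<And>u. u \<bullet> (t *\<^sub>R c + grad F x) \<le> 1 / 4 * local_norm F x u"
  defines "t' \<equiv> (1 + 1 / (13 * sqrt \<nu>)) * t"
  defines "x' \<equiv> x - matrix_inv (hess F x) *v (t' *\<^sub>R c + grad F x)"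
  shows "x' \<in> interior X" and "u \<bullet> (t' *\<^sub>R c + grad F x') \<le> 1 / 4 * local_norm F x' u"
proof -
  have \<nu>: "1 \<le> \<nu>" using nu_ge_1 x by blast
  define \<gamma> where "\<gamma> = 1 / (13 * sqrt \<nu>)"
  have \<gamma>: "0 < \<gamma>" "\<gamma> \<le> 1 / 13" "\<gamma> * sqrt \<nu> = 1 / 13"
    using \<nu> by (auto simp: \<gamma>_def field_simps)
  define g where "g = t' *\<^sub>R c + grad F x"
  define h where "h = - (matrix_inv (hess F x) *v g)"
  have x': "x' = x + h" by (simp add: x'_def h_def g_def)
  have g: "u \<bullet> g \<le> 9 / 26 * local_norm F x u" for u
  proof -
    define N where "N = local_norm F x u"
    have N: "0 \<le> N" using local_norm_nonneg[OF x] by (simp add: N_def)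
    have "g = (1 + \<gamma>) *\<^sub>R (t *\<^sub>R c + grad F x) - \<gamma> *\<^sub>R grad F x"
      unfolding g_def t'_def \<gamma>_def[symmetric] by (simp add: algebra_simps)
    then have "u \<bullet> g = (1 + \<gamma>) * (u \<bullet> (t *\<^sub>R c + grad F x)) - \<gamma> * (grad F x \<bullet> u)"
      by (simp add: inner_diff_right inner_commute)
    also have "\<dots> \<le> (1 + \<gamma>) * (1 / 4 * N) + \<gamma> * (sqrt \<nu> * N)"
    proof -
      have "(1 + \<gamma>) * (u \<bullet> (t *\<^sub>R c + grad F x)) \<le> (1 + \<gamma>) * (1 / 4 * N)"
        using close[of u] \<gamma> by (intro mult_left_mono) (auto simp: N_def)
      moreover have "\<gamma> * (- (grad F x \<bullet> u)) \<le> \<gamma> * (sqrt \<nu> * N)"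
        using grad_bound[OF x, of u] \<gamma> by (intro mult_left_mono) (auto simp: N_def)
      ultimately show ?thesis by simp
    qed
    also have "\<dots> = (1 / 4 + \<gamma> / 4 + \<gamma> * sqrt \<nu>) * N" by (simp add: algebra_simps)
    also have "\<dots> \<le> 9 / 26 * N" using \<gamma> N by (intro mult_right_mono) auto
    finally show ?thesis by (simp add: N_def)
  qed
  have h: "local_norm F x h \<le> 9 / 26"
    unfolding h_def by (rule newton_direction[OF x _ g]) simp
  have Hh: "H x h = - g"
    by (simp add: h_def linear_neg[OF matrix_vector_mul_linear] hess_matrix_inv[OF x])
  show in_x': "x' \<in> interior X"
    using dikin_segment[OF x h, of 1] by (simp add: x')
  have "u \<bullet> (t' *\<^sub>R c + grad F (x + h)) \<le>
      (9 / 26)\<^sup>2 * (3 - 2 * (9 / 26)) / (3 * (1 - 9 / 26)\<^sup>2) * local_norm F (x + h) u"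
  proof (rule newton_step[OF x h])
    show "w \<bullet> (t' *\<^sub>R c + grad F x) = - (w \<bullet> H x h)" for w
      unfolding Hh g_def by (simp only: inner_minus_right minus_minus)
  qed simp
  also have "\<dots> \<le> 1 / 4 * local_norm F (x + h) u"
    using local_norm_nonneg[OF in_x'] by (intro mult_right_mono) (simp_all add: x' power2_eq_square)
  finally show "u \<bullet> (t' *\<^sub>R c + grad F x') \<le> 1 / 4 * local_norm F x' u" by (simp add: x')
qed

text \<open>
  Put \<open>d = y - x\<close>, \<open>r\<close> for its local norm at \<open>x\<close> and \<open>a = grad F x \<bullet> d\<close>; the claim reduces to \<open>a + r/4 \<le> 2 \<nu>\<close>. Suppose it fails. Since
  \<open>a \<le> \<nu>\<close>, this forces \<open>r > 4 \<nu> \<ge> 4\<close>, so the point with parameter \<open>s = 3/r < 1\<close> lies on the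
  segment from \<open>x\<close> to \<open>y\<close>. The slope there is at least \<open>a + 3 r/4\<close>, and \<open>grad_gap\<close> gives
  \<open>(1 - s) (a + 3 r/4) \<le> \<nu>\<close>. Inserting \<open>a > 2 \<nu> - r/4\<close> leaves an inequality in \<open>r\<close> and \<open>\<nu>\<close>
  without solutions.
\<close>

lemma path_gap:
  assumes x: "x \<in> interior X" and y: "y \<in> X"
    and close: "\<And>u. u \<bullet> (t *\<^sub>R c + grad F x) \<le> 1 / 4 * local_norm F x u"
  shows "t * (c \<bullet> x - c \<bullet> y) \<le> 2 * \<nu>"
proof -
  have \<nu>: "1 \<le> \<nu>" using nu_ge_1 x by blast
  define d where "d = y - x"
  define r where "r = local_norm F x d"
  define a where "a = grad F x \<bullet> d"
  have "local_norm F x (- d) = r"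
    by (simp add: r_def local_norm_def linear_neg[OF matrix_vector_mul_linear])
  then have "- d \<bullet> (t *\<^sub>R c + grad F x) \<le> r / 4" using close[of "- d"] by simp
  moreover have "- d \<bullet> (t *\<^sub>R c + grad F x) = t * (c \<bullet> x - c \<bullet> y) - a"
    by (simp add: d_def a_def inner_add_right inner_diff_left inner_diff_right inner_commute algebra_simps)
  moreover have "a + r / 4 \<le> 2 * \<nu>"
  proof (rule ccontr)
    assume far: "\<not> a + r / 4 \<le> 2 * \<nu>"
    moreover have "a \<le> \<nu>" unfolding a_def d_def by (rule grad_gap[OF x y])
    ultimately have r: "4 * \<nu> < r" "4 < r" using \<nu> by auto
    define s where "s = 3 / r"
    have s: "0 < s" "s < 1" "r * s = 3" using r by (auto simp: s_def)
    have inside: "x + q *\<^sub>R d \<in> interior X" if q: "0 \<le> q" "q \<le> s" for q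
    proof -
      have "y - (1 - q) *\<^sub>R (y - x) \<in> interior X"
        using mem_interior_convex_shrink[OF convex_X x y, of "1 - q"] q s by simp
      then show ?thesis by (simp add: d_def algebra_simps)
    qed
    have "a + r\<^sup>2 * s / (1 + r * s) \<le> grad F (x + s *\<^sub>R d) \<bullet> d"
      unfolding a_def r_def using s by (intro grad_along_ge[OF inside]) auto
    moreover have "r\<^sup>2 * s / (1 + r * s) = 3 * r / 4"
      using s by (simp add: power2_eq_square mult.assoc)
    moreover have "grad F (x + s *\<^sub>R d) \<bullet> (y - (x + s *\<^sub>R d)) = (1 - s) * (grad F (x + s *\<^sub>R d) \<bullet> d)"
      by (simp add: d_def inner_diff_right inner_add_right algebra_simps)
    moreover have "grad F (x + s *\<^sub>R d) \<bullet> (y - (x + s *\<^sub>R d)) \<le> \<nu>"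
      using s by (intro grad_gap[OF inside y]) auto
    moreover from calculation(1,2) have
      "(1 - s) * (a + 3 * r / 4) \<le> (1 - s) * (grad F (x + s *\<^sub>R d) \<bullet> d)"
      using s by (intro mult_left_mono) auto
    ultimately have "(1 - s) * (a + 3 * r / 4) \<le> \<nu>" by linarith
    moreover have "(1 - s) * (2 * \<nu> + r / 2) \<le> (1 - s) * (a + 3 * r / 4)"
      using far s by (intro mult_left_mono) auto
    ultimately have "(1 - s) * (2 * \<nu> + r / 2) \<le> \<nu>" by linarith
    then have "r * ((1 - s) * (2 * \<nu> + r / 2)) \<le> r * \<nu>" using r by (intro mult_left_mono) auto
    moreover have "r * ((1 - s) * (2 * \<nu> + r / 2)) = (r - r * s) * (2 * \<nu> + r / 2)"
      by (simp add: algebra_simps)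
    ultimately have "(r - 3) * (2 * \<nu> + r / 2) \<le> r * \<nu>" by (simp add: s)
    \<comment> \<open>Two ways to see that the difference is positive: the first works for \<open>r \<le> 6\<close>, the second
      for \<open>r > 6\<close>.\<close>
    moreover have low: "(r - 3) * (2 * \<nu> + r / 2) - r * \<nu> = 3 / 4 * r * (r - 4) + (r / 4 - \<nu>) * (6 - r)"
      and high: "(r - 3) * (2 * \<nu> + r / 2) - r * \<nu> = \<nu> * (r - 6) + r * (r - 3) / 2"
      by (simp_all add: field_simps)
    moreover have "0 < (r - 3) * (2 * \<nu> + r / 2) - r * \<nu>"
    proof (cases "r \<le> 6")
      case True
      then have "0 \<le> (r / 4 - \<nu>) * (6 - r)" "0 < 3 / 4 * r * (r - 4)" using r by simp_all
      then show ?thesis unfolding low by linarith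
    next
      case False
      then have "0 \<le> \<nu> * (r - 6)" "0 < r * (r - 3) / 2" using r \<nu> by simp_all
      then show ?thesis unfolding high by linarith
    qed
    ultimately show False by linarith
  qed
  ultimately show ?thesis by linarith
qed
end

section \<open>Convergence of the path-following scheme\<close>

text \<open>
  The factor \<open>1 + 1/a\<close> is the inverse of \<open>1 - 1/(1 + a)\<close>, and
  \<open>1 - y \<le> exp (- y)\<close>.
\<close>

lemma geometric_growth_bound:
  fixes a :: real
  assumes "0 < a"
  shows "exp (real k / (1 + a)) \<le> (1 + 1 / a) ^ k"
proof -
  have "1 - 1 / (1 + a) \<le> exp (- (1 / (1 + a)))"
    using exp_ge_add_one_self[of "- (1 / (1 + a))"] by simp
  moreover have "1 - 1 / (1 + a) = inverse (1 + 1 / a)" using assms by (simp add: field_simps)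
  moreover have "exp (- (1 / (1 + a))) = inverse (exp (1 / (1 + a)))" by (rule exp_minus)
  ultimately have "exp (1 / (1 + a)) \<le> 1 + 1 / a"
    using assms by (metis add_pos_pos exp_gt_zero inverse_le_imp_le zero_less_divide_1_iff zero_less_one)
  then have "exp (1 / (1 + a)) ^ k \<le> (1 + 1 / a) ^ k" by (rule power_mono) simp
  then show ?thesis by (simp flip: exp_of_nat_mult)
qed

theorem theorem5p6:
  fixes X :: "(real ^ 'n) set" and c x0 :: "real ^ 'n" and F :: "real ^ 'n \<Rightarrow> real"
    and \<nu> t0 :: real and t :: "nat \<Rightarrow> real" and x :: "nat \<Rightarrow> real ^ 'n"
  assumes "compact X" and "convex X" and "interior X \<noteq> {}"
    and "self_concordant_barrier \<nu> X F"
    and "t0 > 0" and "x0 \<in> interior X"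
    and "newton_decrement (penalized c F t0) x0 \<le> 1 / 4"
    and "t 0 = t0" and "x 0 = x0"
    and "\<And>k. t (Suc k) = (1 + 1 / (13 * sqrt \<nu>)) * t k"
    and "\<And>k. x (Suc k) =
           x k - matrix_inv (hess F (x k)) *v (t (Suc k) *\<^sub>R c + grad F (x k))"
  shows "\<forall>k. c \<bullet> x k - (INF y\<in>X. c \<bullet> y)
               \<le> 2 * \<nu> / t0 * exp (- (real k / (1 + 13 * sqrt \<nu>)))"
proof
  fix k
  interpret self_concordant_barrier_on X F \<nu>
    using assms by unfold_locales
  define a where "a = 13 * sqrt \<nu>"
  have a: "0 < a" using nu_pos by (simp add: a_def)
  have t: "t k = t0 * (1 + 1 / a) ^ k" for k
    by (induction k) (simp_all add: assms(8,10) a_def)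
  have path: "x k \<in> interior X \<and>
      (\<forall>u. u \<bullet> (t k *\<^sub>R c + grad F (x k)) \<le> 1 / 4 * local_norm F (x k) u)" for k
  proof (induction k)
    case 0
    have "u \<bullet> (t0 *\<^sub>R c + grad F x0) \<le> 1 / 4 * local_norm F x0 u" for u
    proof -
      have "u \<bullet> (t0 *\<^sub>R c + grad F x0)
          \<le> newton_decrement (penalized c F t0) x0 * local_norm F x0 u"
        using inner_le_dual_local_norm assms(6) by (simp add: newton_decrement_penalized)
      also have "\<dots> \<le> 1 / 4 * local_norm F x0 u"
        using assms(7) local_norm_nonneg[OF assms(6)] by (rule mult_right_mono)
      finally show ?thesis .
    qed
    then show ?case by (simp add: assms(6,8,9))
  next
    case (Suc k)
    then show ?case
      using path_following_step[of "x k" "t k" c] unfolding assms(11) assms(10) by blast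
  qed
  have tk: "t0 * exp (real k / (1 + a)) \<le> t k"
    unfolding t using geometric_growth_bound[OF a] assms(5) by (intro mult_left_mono) auto
  have pos: "0 < t0 * exp (real k / (1 + a))" using assms(5) by simp
  have "c \<bullet> x k - 2 * \<nu> / t k \<le> (INF y\<in>X. c \<bullet> y)"
  proof (rule cINF_greatest)
    show "X \<noteq> {}" using assms(3) interior_subset by blast
    fix y assume "y \<in> X"
    then have "t k * (c \<bullet> x k - c \<bullet> y) \<le> 2 * \<nu>" using path[of k] by (intro path_gap) auto
    then show "c \<bullet> x k - 2 * \<nu> / t k \<le> c \<bullet> y"
      using tk pos by (simp add: field_simps)
  qed
  moreover have "2 * \<nu> / t k \<le> 2 * \<nu> / (t0 * exp (real k / (1 + a)))"
    using tk pos nu_pos by (intro divide_left_mono) auto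
  moreover have "2 * \<nu> / (t0 * exp (real k / (1 + a))) = 2 * \<nu> / t0 * exp (- (real k / (1 + a)))"
    by (simp add: exp_minus field_simps)
  ultimately show "c \<bullet> x k - (INF y\<in>X. c \<bullet> y)
      \<le> 2 * \<nu> / t0 * exp (- (real k / (1 + 13 * sqrt \<nu>)))"
    unfolding a_def by linarith
qed

end
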